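(* Let $G$ be a connected $K_4$-minor-free graph with $|V(G)|\ge 2$, let $\mathcal{F}$ be the set of all nontrivial 2-cuts of $G$, and for $v\in V(G)$ let $\mathcal{F}(v)=\{F\in\mathcal{F} : v\in F\}$. Suppose there is an integer $f(v)\ge 2$ for each $v\in V(G)$ and a nonnegative integer function $\omega$ on ordered pairs $(F,u)$ with $F\in\mathcal{F}$ and $u\in F$ such that $$\omega(F,u)+\omega(F,v)=c(G,F)-2\quad\text{for all } F=\{u,v\}\in\mathcal{F},$$ $$\sum_{F\in\mathcal{F}(u)}\omega(F,u)+c(G-u)-1\le f(u)-2\quad\text{for all } u\in V(G).$$ Choose a root edge $r_0s_0\in E(G)$ such that $c(G,r_0s_0)\le 1$. Let the blocks of $G$ be $B_0,B_1,\dots,B_k$, where $r_0s_0\in E(B_0)$. For each $i=1,\dots,k$, let $r_i$ be the root vertex of $B_i$, and choose $r_is_i\in E(B_i)$ with $c(G,r_is_i)\le 1$. Then $G$ has a spanning tree $T$ such that $d_T(v)\le f(v)$ for all $v\in V(G)$ and $d_T(v)\le f(v)-1$ for all $v\in\{r_0\}\cup\{s_0,s_1,\dots,s_k\}$. Furthermore, for $0\le i\le k$, $r_is_i\in E(T)$ if $c(G,r_is_i)=0$, and $r_is_i\notin E(T)$ if $c(G,r_is_i)=1$.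
   Context: All graphs are simple and finite; $c(H)$ is the number of components of $H$ and $G-u$ is $G$ with vertex $u$ deleted. For $S\subseteq V(G)$, an $S$-bridge is either an edge joining two vertices of $S$ (trivial bridge) or a component of $G-S$ together with all edges joining it to $S$ (nontrivial bridge). For a set $F=\{u,v\}$ of two vertices (not necessarily adjacent), $c(G,F)=c(G,uv)$ denotes the number of nontrivial $F$-bridges of $G$ that contain both $u$ and $v$. A nontrivial 2-cut of $G$ is a set $F$ of two vertices with $c(G,F)\ge 3$. A block is a connected graph with no cutvertex; a block of $G$ is a maximal connected subgraph of $G$ that is a block. The block-cutvertex tree of $G$ has as vertices the blocks and cutvertices, with a cutvertex adjacent to each block containing it; the block $B_0$ containing the root edge is the root of this tree, and the root vertex of a block $B_i\ne B_0$ is its parent cutvertex in the rooted block-cutvertex tree. A graph is $K_4$-minor-free if no graph isomorphic to $K_4$ can be obtained from it by edge contractions, edge deletions and vertex deletions. *)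

theory Defs
  imports Main
begin

text \<open>A graph is a pair of a vertex set and a set of edges, an edge being the two-element set
  of its ends.\<close>

type_synonym 'a graph = "'a set \<times> 'a set set"

abbreviation vset :: "'a graph \<Rightarrow> 'a set" where "vset G \<equiv> fst G"
abbreviation eset :: "'a graph \<Rightarrow> 'a set set" where "eset G \<equiv> snd G"

definition simple_graph :: "'a graph \<Rightarrow> bool" where
  "simple_graph G \<longleftrightarrow> finite (vset G) \<and> (\<forall>e\<in>eset G. e \<subseteq> vset G \<and> card e = 2)"

definition adjacent :: "'a graph \<Rightarrow> 'a \<Rightarrow> 'a \<Rightarrow> bool" where
  "adjacent G u v \<longleftrightarrow> {u, v} \<in> eset G"

definition vdegree :: "'a graph \<Rightarrow> 'a \<Rightarrow> nat" where
  "vdegree G v = card {e \<in> eset G. v \<in> e}"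

definition is_subgraph :: "'a graph \<Rightarrow> 'a graph \<Rightarrow> bool" where
  "is_subgraph H G \<longleftrightarrow>
     vset H \<subseteq> vset G \<and> eset H \<subseteq> eset G \<and> (\<forall>e\<in>eset H. e \<subseteq> vset H)"

definition maximal_subgraphs :: "('a graph \<Rightarrow> bool) \<Rightarrow> 'a graph \<Rightarrow> 'a graph set" where
  "maximal_subgraphs P G =
     {H. is_subgraph H G \<and> P H \<and>
         (\<forall>H'. is_subgraph H' G \<and> P H' \<and> is_subgraph H H' \<longrightarrow> H' = H)}"

definition delete_vertices :: "'a graph \<Rightarrow> 'a set \<Rightarrow> 'a graph" where
  "delete_vertices G S = (vset G - S, {e \<in> eset G. e \<inter> S = {}})"

definition graph_path :: "'a graph \<Rightarrow> 'a list \<Rightarrow> bool" where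
  "graph_path G p \<longleftrightarrow>
     p \<noteq> [] \<and> distinct p \<and> set p \<subseteq> vset G \<and> successively (adjacent G) p"

text \<open>The null graph is not connected, so that it has no components.\<close>

definition graph_connected :: "'a graph \<Rightarrow> bool" where
  "graph_connected G \<longleftrightarrow>
     vset G \<noteq> {} \<and>
     (\<forall>u\<in>vset G. \<forall>v\<in>vset G. \<exists>p. graph_path G p \<and> hd p = u \<and> last p = v)"

definition graph_components :: "'a graph \<Rightarrow> 'a graph set" where
  "graph_components G = maximal_subgraphs graph_connected G"

definition num_components :: "'a graph \<Rightarrow> nat" where
  "num_components G = card (graph_components G)"

definition graph_cycle :: "'a graph \<Rightarrow> 'a list \<Rightarrow> bool" where
  "graph_cycle G p \<longleftrightarrow> graph_path G p \<and> length p \<ge> 3 \<and> adjacent G (last p) (hd p)"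

definition is_tree :: "'a graph \<Rightarrow> bool" where
  "is_tree T \<longleftrightarrow> graph_connected T \<and> \<not> (\<exists>p. graph_cycle T p)"

definition is_spanning_tree :: "'a graph \<Rightarrow> 'a graph \<Rightarrow> bool" where
  "is_spanning_tree T G \<longleftrightarrow> is_subgraph T G \<and> vset T = vset G \<and> is_tree T"

text \<open>In the tree \<open>T\<close> rooted at \<open>root\<close>, \<open>y\<close> is the parent of \<open>x\<close>: the second vertex of the path
  from \<open>x\<close> to the root.\<close>

definition tree_parent :: "'a graph \<Rightarrow> 'a \<Rightarrow> 'a \<Rightarrow> 'a \<Rightarrow> bool" where
  "tree_parent T root x y \<longleftrightarrow> (\<exists>p. graph_path T (x # y # p) \<and> last (y # p) = root)"

definition bridge_of :: "'a graph \<Rightarrow> 'a set \<Rightarrow> 'a graph \<Rightarrow> 'a graph" where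
  "bridge_of G S C =
     (vset C \<union> {s \<in> S. \<exists>x\<in>vset C. {x, s} \<in> eset G},
      eset C \<union> {{x, s} | x s. x \<in> vset C \<and> s \<in> S \<and> {x, s} \<in> eset G})"

definition nontrivial_bridges :: "'a graph \<Rightarrow> 'a set \<Rightarrow> 'a graph set" where
  "nontrivial_bridges G S = bridge_of G S ` graph_components (delete_vertices G S)"

definition num_bridges :: "'a graph \<Rightarrow> 'a set \<Rightarrow> nat" where
  "num_bridges G F = card {D \<in> nontrivial_bridges G F. F \<subseteq> vset D}"

definition nontrivial_2cuts :: "'a graph \<Rightarrow> 'a set set" where
  "nontrivial_2cuts G = {F. F \<subseteq> vset G \<and> card F = 2 \<and> num_bridges G F \<ge> 3}"

definition cutvertex :: "'a graph \<Rightarrow> 'a \<Rightarrow> bool" where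
  "cutvertex G v \<longleftrightarrow>
     v \<in> vset G \<and> num_components (delete_vertices G {v}) > num_components G"

definition is_block :: "'a graph \<Rightarrow> bool" where
  "is_block B \<longleftrightarrow> graph_connected B \<and> \<not> (\<exists>v. cutvertex B v)"

definition graph_blocks :: "'a graph \<Rightarrow> 'a graph set" where
  "graph_blocks G = maximal_subgraphs is_block G"

definition block_cutvertex_tree :: "'a graph \<Rightarrow> ('a graph + 'a) graph" where
  "block_cutvertex_tree G =
     (Inl ` graph_blocks G \<union> Inr ` {v. cutvertex G v},
      {{Inl B, Inr v} | B v. B \<in> graph_blocks G \<and> cutvertex G v \<and> v \<in> vset B})"

definition block_root_vertex :: "'a graph \<Rightarrow> 'a graph \<Rightarrow> 'a graph \<Rightarrow> 'a \<Rightarrow> bool" where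
  "block_root_vertex G B0 B r \<longleftrightarrow>
     tree_parent (block_cutvertex_tree G) (Inl B0) (Inl B) (Inr r)"

text \<open>Contracting the edge \<open>{u, v}\<close> identifies \<open>v\<close> with \<open>u\<close>; the loop and the parallel edges
  that arise are discarded, so the result is again simple.\<close>

definition contract_edge :: "'a graph \<Rightarrow> 'a \<Rightarrow> 'a \<Rightarrow> 'a graph" where
  "contract_edge G u v =
     (let h = (\<lambda>x. if x = v then u else x)
      in (h ` vset G, {h ` e | e. e \<in> eset G \<and> e \<noteq> {u, v}}))"

inductive minor_step :: "'a graph \<Rightarrow> 'a graph \<Rightarrow> bool" where
  delete_edge: "e \<in> eset G \<Longrightarrow> minor_step G (vset G, eset G - {e})"
| delete_vertex: "v \<in> vset G \<Longrightarrow> minor_step G (delete_vertices G {v})"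
| contract: "{u, v} \<in> eset G \<Longrightarrow> minor_step G (contract_edge G u v)"

definition graph_iso :: "'a graph \<Rightarrow> 'b graph \<Rightarrow> bool" where
  "graph_iso G H \<longleftrightarrow> (\<exists>h. bij_betw h (vset G) (vset H) \<and> eset H = (\<lambda>e. h ` e) ` eset G)"

definition complete_graph :: "nat \<Rightarrow> nat graph" where
  "complete_graph n = ({..<n}, {e. e \<subseteq> {..<n} \<and> card e = 2})"

definition K4_minor_free :: "'a graph \<Rightarrow> bool" where
  "K4_minor_free G \<longleftrightarrow> \<not> (\<exists>H. minor_step\<^sup>*\<^sup>* G H \<and> graph_iso H (complete_graph 4))"

end

theory Submission
  imports Defs
begin

text \<open>Degree upper bounds and forbidden edges are inherited by subgraphs, and an edge \<open>rs\<close> with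
  \<open>c(G, rs) = 0\<close> is a bridge; so it suffices to find a connected spanning edge set satisfying the
  bounds and avoiding the edges \<open>r\<^sub>is\<^sub>i\<close> with \<open>c(G, r\<^sub>is\<^sub>i) = 1\<close>.

  Such a set is built by recursion on vertex sets, hanging either from one vertex \<open>v\<close> (a component
  of \<open>G - v\<close> away from the root) or between two vertices \<open>x, y\<close> (a component \<open>W\<close> of
  \<open>G - {x, y}\<close> attached to both). In the latter case, \<open>K\<^sub>4\<close>-minor-freeness gives a vertex
  \<open>v\<close> of \<open>W\<close> that separates \<open>x\<close> from \<open>y\<close> inside the piece, so the piece splits into pieces
  between \<open>x, v\<close>, pieces between \<open>v, y\<close> and pieces hanging from \<open>v\<close>. If \<open>p\<close> pieces lie between
  \<open>x\<close> and \<open>v\<close>, then \<open>c(G, xv) = p + 1\<close>, and \<open>p - 1\<close> of their edge sets can spare an edge at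
  \<open>x\<close> or at \<open>v\<close>; the weights \<open>\<omega>\<close> of the 2-cut \<open>{x, v}\<close> decide at which end. A piece hanging
  from \<open>v\<close> is reduced to these two kinds by means of the chosen edge \<open>vs\<close>.\<close>

section \<open>Connectivity inside a vertex set\<close>

text \<open>The constants come from one account. A piece costs each terminal one edge plus the
  weights of 2-cuts formed with its own vertices. A splitting vertex \<open>v\<close> pays one edge
  towards \<open>x\<close>, one towards \<open>y\<close> and one per hanging piece. As
  \<open>G - v\<close> has the hanging pieces and the component of \<open>x\<close> as components,
  this is at most \<open>c(G - v) + 1\<close> plus weights, exactly what \<open>f(v)\<close> is sure
  to allow; so \<open>v\<close> must not be an \<open>s_i\<close>. A chosen vertex
  \<open>t = s_i\<close> has only one direction besides its hanging pieces, and \<open>r_0\<close>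
  has hanging pieces only: both save the required 1. Every weight at a vertex is spent once, because
  the vertex sets to which its weights are allotted are disjoint. An edge can be spared because,
  once one piece joins \<open>x\<close> to \<open>v\<close>, another one that loses a suitable edge
  at \<open>x\<close> still has each of its vertices attached to \<open>x\<close> or to
  \<open>v\<close>. The obstacle is that an edge the recursion wants may be forbidden. A chosen
  \<open>s_i\<close> is separated from the root by \<open>r_i\<close>, whereas deleting a vertex of
  a piece never cuts a terminal off from the root; this excludes the bad chosen pairs.\<close>

inductive linked :: "'a set set \<Rightarrow> 'a set \<Rightarrow> 'a \<Rightarrow> 'a \<Rightarrow> bool" for E A where
  linked_refl: "a \<in> A \<Longrightarrow> linked E A a a"
| linked_step: "linked E A a b \<Longrightarrow> {b, c} \<in> E \<Longrightarrow> c \<in> A \<Longrightarrow> linked E A a c"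

text \<open>Deleting vertices means shrinking \<open>A\<close> while \<open>E\<close> stays fixed:
  only edges with both ends in \<open>A\<close> are ever traversed, so no subgraph has to be
  built.\<close>

definition connected_in :: "'a set set \<Rightarrow> 'a set \<Rightarrow> bool" where
  "connected_in E A \<longleftrightarrow> A \<noteq> {} \<and> (\<forall>a\<in>A. \<forall>b\<in>A. linked E A a b)"

definition part :: "'a set set \<Rightarrow> 'a set \<Rightarrow> 'a \<Rightarrow> 'a set" where
  "part E A a = {b. linked E A a b}"

definition parts :: "'a set set \<Rightarrow> 'a set \<Rightarrow> 'a set set" where
  "parts E A = part E A ` A"

definition touches :: "'a set set \<Rightarrow> 'a set \<Rightarrow> 'a set \<Rightarrow> bool" where
  "touches E A B \<longleftrightarrow> (\<exists>a\<in>A. \<exists>b\<in>B. {a, b} \<in> E)"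

lemma linked_in: "linked E A a b \<Longrightarrow> a \<in> A \<and> b \<in> A"
  by (induction rule: linked.induct) auto

lemma linked_trans: "linked E A b c \<Longrightarrow> linked E A a b \<Longrightarrow> linked E A a c"
  by (induction rule: linked.induct) (auto intro: linked_step)

lemma linked_edge: "{a, b} \<in> E \<Longrightarrow> a \<in> A \<Longrightarrow> b \<in> A \<Longrightarrow> linked E A a b"
  by (auto intro: linked.intros)

lemma linked_sym: "linked E A a b \<Longrightarrow> linked E A b a"
proof (induction rule: linked.induct)
  case (linked_step a b c)
  then have "linked E A c b"
    by (metis linked_edge linked_in insert_commute)
  then show ?case using linked_step linked_trans by metis
qed (auto intro: linked_refl)

lemma linked_mono: "linked E A a b \<Longrightarrow> E \<subseteq> E' \<Longrightarrow> A \<subseteq> A' \<Longrightarrow> linked E' A' a b"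
  by (induction rule: linked.induct) (auto intro: linked.intros)

lemma linked_closed:
  assumes "linked E A a b" "a \<in> K" "\<And>c d. c \<in> K \<Longrightarrow> c \<in> A \<Longrightarrow> d \<in> A \<Longrightarrow> {c, d} \<in> E \<Longrightarrow> d \<in> K"
  shows "linked E (A \<inter> K) a b"
  using assms(1,2)
proof (induction rule: linked.induct)
  case (linked_step a b c)
  then have "linked E (A \<inter> K) a b" by simp
  then show ?case using linked_step assms(3)[of b c] linked_in
    by (metis IntD1 IntD2 IntI linked.linked_step)
qed (auto intro: linked_refl)

text \<open>Cut the walk just before its first visit of \<open>x\<close>; \<open>z\<close> is the
  vertex reached there.\<close>

lemma linked_first_hit:
  assumes "linked E A a x" "a \<noteq> x"
  shows "\<exists>z. linked E (A - {x}) a z \<and> {z, x} \<in> E"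
proof -
  have "(linked E (A - {x}) a b) \<or> (\<exists>z. linked E (A - {x}) a z \<and> {z, x} \<in> E)"
    if "linked E A a b" "a \<noteq> x" for b
    using that
    by (induction rule: linked.induct) (auto intro: linked.intros)
  from this[OF assms] show ?thesis
    using linked_in by fastforce
qed

lemma linked_Diff_edge: "linked E (A - {x}) a b \<Longrightarrow> x \<in> e \<Longrightarrow> linked (E - {e}) A a b"
proof (induction rule: linked.induct)
  case (linked_step a b c)
  then have "b \<noteq> x" "c \<noteq> x" "c \<in> A" using linked_in by fast+
  then have "{b, c} \<in> E - {e}" using linked_step by blast
  then show ?case using linked_step \<open>c \<in> A\<close> linked.linked_step by metis
qed (auto intro: linked_refl)

lemma part_self: "a \<in> A \<Longrightarrow> a \<in> part E A a"
  by (simp add: part_def linked_refl)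

lemma part_subset: "part E A a \<subseteq> A"
  by (auto simp: part_def dest: linked_in)

lemma part_eq: "linked E A a b \<Longrightarrow> part E A a = part E A b"
  unfolding part_def using linked_sym linked_trans by fast

lemma connected_part: assumes "a \<in> A" shows "connected_in E (part E A a)"
proof -
  have *: "linked E (part E A a) a b" if "linked E A a b" for b
  proof -
    have "linked E (A \<inter> part E A a) a b"
      by (rule linked_closed[OF that]) (auto simp: part_def intro: linked_refl linked_step assms)
    then show ?thesis by (rule linked_mono) auto
  qed
  then show ?thesis
    unfolding connected_in_def using part_self[OF assms, of E]
    by (metis empty_iff linked_sym linked_trans mem_Collect_eq part_def)
qed

lemma parts_connected: "K \<in> parts E A \<Longrightarrow> connected_in E K"
  by (auto simp: parts_def connected_part)

lemma parts_subset: "K \<in> parts E A \<Longrightarrow> K \<subseteq> A"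
  by (auto simp: parts_def dest: subsetD[OF part_subset])

lemma parts_nonempty: "K \<in> parts E A \<Longrightarrow> K \<noteq> {}"
  using parts_connected connected_in_def by metis

lemma parts_eq_part: "K \<in> parts E A \<Longrightarrow> a \<in> K \<Longrightarrow> K = part E A a"
proof -
  assume "K \<in> parts E A" "a \<in> K"
  then obtain x where "K = part E A x" "linked E A x a" by (auto simp: parts_def part_def)
  then show "K = part E A a" using part_eq by metis
qed

lemma parts_disjoint: "K \<in> parts E A \<Longrightarrow> K' \<in> parts E A \<Longrightarrow> a \<in> K \<Longrightarrow> a \<in> K' \<Longrightarrow> K = K'"
  using parts_eq_part by metis

lemma parts_closed: "K \<in> parts E A \<Longrightarrow> c \<in> K \<Longrightarrow> d \<in> A \<Longrightarrow> {c, d} \<in> E \<Longrightarrow> d \<in> K"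
  by (auto simp: parts_def part_def intro: linked_step)

lemma parts_linked: "K \<in> parts E A \<Longrightarrow> a \<in> K \<Longrightarrow> linked E A a b \<Longrightarrow> b \<in> K"
  using parts_eq_part part_def by fastforce

lemma Union_parts: "\<Union> (parts E A) = A"
  using part_self part_subset by (fastforce simp: parts_def)

lemma parts_cover: "a \<in> A \<Longrightarrow> \<exists>K\<in>parts E A. a \<in> K"
  using part_self by (fastforce simp: parts_def)

lemma finite_parts: "finite A \<Longrightarrow> finite (parts E A)"
  by (simp add: parts_def)

lemma connected_in_linked: "connected_in E A \<Longrightarrow> a \<in> A \<Longrightarrow> b \<in> A \<Longrightarrow> linked E A a b"
  by (simp add: connected_in_def)

lemma connected_inI: "a \<in> A \<Longrightarrow> (\<And>b. b \<in> A \<Longrightarrow> linked E A a b) \<Longrightarrow> connected_in E A"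
  unfolding connected_in_def by (metis empty_iff linked_sym linked_trans)

text \<open>This is how components of a piece minus a vertex are recognized as components of the
  whole graph minus a few vertices: only closure under edges has to be checked.\<close>

lemma connected_partsI:
  assumes "connected_in E K" "K \<subseteq> A" "\<And>c d. c \<in> K \<Longrightarrow> d \<in> A \<Longrightarrow> {c, d} \<in> E \<Longrightarrow> d \<in> K"
  shows "K \<in> parts E A"
proof -
  obtain a where a: "a \<in> K" using assms(1) by (auto simp: connected_in_def)
  have "b \<in> K" if "linked E A a b" for b
  proof -
    have "linked E (A \<inter> K) a b" by (rule linked_closed[OF that a]) (rule assms(3))
    then show ?thesis by (auto dest: linked_in)
  qed
  moreover have "linked E A a b" if "b \<in> K" for b
    using linked_mono[OF connected_in_linked[OF assms(1) a that] order_refl assms(2)] .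
  ultimately have "K = part E A a" by (auto simp: part_def)
  then show ?thesis using a assms(2) by (auto simp: parts_def)
qed

lemma parts_connected_eq:
  assumes con: "connected_in E A" shows "parts E A = {A}"
proof -
  have A: "A \<in> parts E A" by (rule connected_partsI[OF con]) auto
  have "K = A" if "K \<in> parts E A" for K
    using parts_disjoint[OF that A] parts_nonempty[OF that] parts_subset[OF that] by blast
  then show ?thesis using A by blast
qed

lemma connected_Un:
  assumes "connected_in E A" "connected_in E B" "A \<inter> B \<noteq> {}"
  shows "connected_in E (A \<union> B)"
proof -
  obtain a where a: "a \<in> A" "a \<in> B" using assms(3) by auto
  show ?thesis
  proof (rule connected_inI)
    show "a \<in> A \<union> B" using a by simp
    show "linked E (A \<union> B) a b" if "b \<in> A \<union> B" for b
      using that a assms connected_in_linked linked_mono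
      by (metis Un_iff order_refl sup_ge1 sup_ge2)
  qed
qed

lemma connected_Un_edge:
  assumes "connected_in E A" "connected_in E B" "touches E A B"
  shows "connected_in E (A \<union> B)"
proof -
  obtain a b where ab: "a \<in> A" "b \<in> B" "{a, b} \<in> E" using assms(3) by (auto simp: touches_def)
  show ?thesis
  proof (rule connected_inI)
    show "a \<in> A \<union> B" using ab by simp
    have "linked E (A \<union> B) a b" using ab by (auto intro: linked_edge)
    then show "linked E (A \<union> B) a c" if "c \<in> A \<union> B" for c
      using that ab assms connected_in_linked linked_mono linked_trans
      by (metis Un_iff order_refl sup_ge1 sup_ge2)
  qed
qed

lemma connected_singleton: "connected_in E {a}"
  by (auto simp: connected_in_def intro: linked_refl)

lemma touches_sym: "touches E A B \<longleftrightarrow> touches E B A"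
  unfolding touches_def by (metis insert_commute)

lemma touches_mono: "touches E A B \<Longrightarrow> A \<subseteq> A' \<Longrightarrow> B \<subseteq> B' \<Longrightarrow> touches E A' B'"
  by (auto simp: touches_def)

lemma part_touches:
  assumes "connected_in E W" "v \<in> W" "D \<in> parts E (W - {v})"
  shows "touches E D {v}"
proof -
  obtain d where d: "d \<in> D" using parts_nonempty[OF assms(3)] by auto
  then have "d \<in> W" "d \<noteq> v" using parts_subset[OF assms(3)] by auto
  then obtain z where z: "linked E (W - {v}) d z" "{z, v} \<in> E"
    using linked_first_hit connected_in_linked[OF assms(1)] assms(2) by metis
  then have "z \<in> D" using parts_linked[OF assms(3) d] by simp
  then show ?thesis using z by (auto simp: touches_def)
qed

text \<open>Every other component of \<open>W - {v}\<close> is adjacent to \<open>v\<close>, so what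
  remains hangs together at \<open>v\<close>.\<close>

lemma connected_Diff_part:
  assumes "connected_in E W" "v \<in> W" "D \<in> parts E (W - {v})"
  shows "connected_in E (W - D)"
proof (rule connected_inI)
  show "v \<in> W - D" using assms parts_subset by fastforce
  fix b assume b: "b \<in> W - D"
  show "linked E (W - D) v b"
  proof (cases "b = v")
    case True then show ?thesis using b by (auto intro: linked_refl)
  next
    case False
    then obtain K where K: "K \<in> parts E (W - {v})" "b \<in> K" using parts_cover b by (metis DiffD1 DiffI empty_iff insert_iff)
    then have dis: "K \<inter> D = {}" using parts_disjoint assms(3) b by (metis DiffD2 disjoint_iff)
    have "touches E K {v}" using part_touches assms K by metis
    then have "connected_in E (K \<union> {v})" using connected_Un_edge parts_connected[OF K(1)] connected_singleton by metis
    then have "linked E (K \<union> {v}) v b" using K connected_in_linked by fastforce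
    then show ?thesis by (rule linked_mono) (use dis parts_subset[OF K(1)] parts_subset[OF assms(3)] assms(2) in auto)
  qed
qed

section \<open>Four touching connected sets and separating vertices\<close>

text \<open>The branch sets of a \<open>K4\<close> minor; only the values of \<open>b\<close> below
  4 matter.\<close>

definition K4_model :: "'a set set \<Rightarrow> 'a set \<Rightarrow> (nat \<Rightarrow> 'a set) \<Rightarrow> bool" where
  "K4_model E V b \<longleftrightarrow>
     (\<forall>i<4. connected_in E (b i) \<and> b i \<subseteq> V) \<and>
     (\<forall>i<4. \<forall>j<4. i \<noteq> j \<longrightarrow> b i \<inter> b j = {} \<and> touches E (b i) (b j))"

lemma K4_modelI:
  assumes "connected_in E A" "connected_in E B" "connected_in E C" "connected_in E D"
    "A \<union> B \<union> C \<union> D \<subseteq> V"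
    "A \<inter> B = {}" "A \<inter> C = {}" "A \<inter> D = {}" "B \<inter> C = {}" "B \<inter> D = {}" "C \<inter> D = {}"
    "touches E A B" "touches E A C" "touches E A D" "touches E B C" "touches E B D" "touches E C D"
  shows "K4_model E V (\<lambda>i. if i = 0 then A else if i = 1 then B else if i = 2 then C else D)"
  using assms touches_sym[of E] unfolding K4_model_def by auto

text \<open>Edges collapsed by \<open>h\<close> may vanish, which covers contractions; with
  \<open>h = id\<close> walks are transferred to another edge set.\<close>

lemma linked_map:
  assumes "linked E A a b" "\<And>c d. c \<in> A \<Longrightarrow> d \<in> A \<Longrightarrow> {c, d} \<in> E \<Longrightarrow> h c \<noteq> h d \<Longrightarrow> {h c, h d} \<in> E'"
  shows "linked E' (h ` A) (h a) (h b)"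
  using assms(1)
proof (induction rule: linked.induct)
  case (linked_step a b c)
  then have "b \<in> A" using linked_in by fast
  show ?case
  proof (cases "h b = h c")
    case False
    then show ?thesis using linked_step \<open>b \<in> A\<close> assms(2) by (metis imageI linked.linked_step)
  qed (use linked_step in simp)
qed (auto intro: linked_refl)

lemma connected_map:
  assumes "connected_in E A" "\<And>c d. c \<in> A \<Longrightarrow> d \<in> A \<Longrightarrow> {c, d} \<in> E \<Longrightarrow> h c \<noteq> h d \<Longrightarrow> {h c, h d} \<in> E'"
  shows "connected_in E' (h ` A)"
proof -
  obtain a where a: "a \<in> A" using assms(1) by (auto simp: connected_in_def)
  show ?thesis
  proof (rule connected_inI)
    show "h a \<in> h ` A" using a by simp
    fix b assume "b \<in> h ` A"
    then obtain b' where "b = h b'" "b' \<in> A" by blast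
    then show "linked E' (h ` A) (h a) b"
      using linked_map[OF connected_in_linked[OF assms(1) a] assms(2)] by simp
  qed
qed

text \<open>The branch sets then amount to four vertices, pairwise adjacent, and nothing else; since
  edges have two ends, there is no further edge.\<close>

lemma K4_minor_if_singletons:
  assumes G: "simple_graph G" and m: "K4_model (eset G) (vset G) b"
    and cover: "vset G \<subseteq> (\<Union>i<4. b i)" and single: "\<And>i. i < 4 \<Longrightarrow> card (b i) \<le> 1"
  shows "graph_iso G (complete_graph 4)"
proof -
  have fin: "finite (b i)" "b i \<noteq> {}" "b i \<subseteq> vset G" if "i < 4" for i
    using m G that unfolding K4_model_def simple_graph_def connected_in_def by (meson finite_subset)+
  then have "card (b i) = 1" if "i < 4" for i
    using single[OF that] that by (metis One_nat_def card_gt_0_iff le_antisym Suc_leI)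
  then have "\<forall>i\<in>{..<4}. \<exists>c. b i = {c}" by (simp add: card_1_singleton_iff)
  then obtain c where c: "\<And>i. i < 4 \<Longrightarrow> b i = {c i}" by (metis lessThan_iff)
  have inj: "inj_on c {..<4}"
  proof (rule inj_onI)
    fix i j :: nat assume "i \<in> {..<4}" "j \<in> {..<4}" "c i = c j"
    then show "i = j" using m c[of i] c[of j] unfolding K4_model_def by fastforce
  qed
  have V: "c ` {..<4} = vset G"
  proof
    show "c ` {..<4} \<subseteq> vset G" using fin(3) c by fastforce
    show "vset G \<subseteq> c ` {..<4}" using cover c by fastforce
  qed
  have edge: "{c i, c j} \<in> eset G" if "i < 4" "j < 4" "i \<noteq> j" for i j
  proof -
    have "touches (eset G) (b i) (b j)" using m that unfolding K4_model_def by blast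
    then show ?thesis using c that by (simp add: touches_def)
  qed
  have E: "eset G = (\<lambda>e. c ` e) ` eset (complete_graph 4)"
  proof (intro equalityI subsetI)
    fix e assume e: "e \<in> eset G"
    then have "e \<subseteq> vset G" "card e = 2" using G by (auto simp: simple_graph_def)
    define e' where "e' = {i\<in>{..<4}. c i \<in> e}"
    have "e = c ` e'" using \<open>e \<subseteq> vset G\<close> V unfolding e'_def by auto
    moreover have "card e' = 2"
      using \<open>card e = 2\<close> calculation inj card_image inj_on_subset[of c "{..<4}" e'] unfolding e'_def
      by (metis (no_types, lifting) mem_Collect_eq subsetI)
    ultimately show "e \<in> (\<lambda>e. c ` e) ` eset (complete_graph 4)"
      by (auto simp: complete_graph_def e'_def)
  next
    fix e assume "e \<in> (\<lambda>e. c ` e) ` eset (complete_graph 4)"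
    then obtain e' where "e = c ` e'" "e' \<subseteq> {..<4}" "card e' = 2" by (auto simp: complete_graph_def)
    then show "e \<in> eset G" using edge by (fastforce simp: card_2_iff)
  qed
  define h where "h = the_inv_into {..<4} c"
  have "bij_betw h (vset G) {..<4}"
    unfolding h_def using inj V by (metis bij_betw_imageI bij_betw_the_inv_into)
  moreover have "eset (complete_graph 4) = (\<lambda>e. h ` e) ` eset G"
  proof -
    have "h ` c ` e' = e'" if "e' \<subseteq> {..<4}" for e'
    proof -
      have "h (c i) = i" if "i \<in> e'" for i
        unfolding h_def using inj that \<open>e' \<subseteq> {..<4}\<close> by (meson subsetD the_inv_into_f_f)
      then show ?thesis by (force simp: image_image)
    qed
    then have "\<forall>e'\<in>eset (complete_graph 4). h ` c ` e' = e'" by (auto simp: complete_graph_def)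
    then show ?thesis unfolding E by (simp add: image_image cong: image_cong)
  qed
  ultimately show ?thesis unfolding graph_iso_def by (auto simp: complete_graph_def)
qed

lemma K4_model_delete_vertex:
  assumes m: "K4_model (eset G) (vset G) b" and z: "z \<notin> (\<Union>i<4. b i)"
  shows "K4_model (eset (delete_vertices G {z})) (vset (delete_vertices G {z})) b"
proof -
  let ?E = "eset (delete_vertices G {z})"
  have keep: "{c, d} \<in> ?E" if "{c, d} \<in> eset G" "c \<in> b i" "d \<in> b j" "i < 4" "j < 4" for c d i j
    using that z by (auto simp: delete_vertices_def)
  have "connected_in ?E (id ` b i)" if "i < 4" for i
    by (rule connected_map[of "eset G"]) (use m keep that in \<open>auto simp: K4_model_def\<close>)
  moreover have "touches ?E (b i) (b j)" if "i < 4" "j < 4" "i \<noteq> j" for i j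
    using m that keep unfolding K4_model_def touches_def by meson
  ultimately show ?thesis
    using m z unfolding K4_model_def by (fastforce simp: delete_vertices_def)
qed

text \<open>The merged vertices lie in one branch set, so images of different branch sets stay
  disjoint, and hence no edge between two of them collapses.\<close>

lemma K4_model_contract:
  assumes m: "K4_model (eset G) (vset G) b" and i: "i < 4" "u \<in> b i" "v \<in> b i" "u \<noteq> v"
  shows "K4_model (eset (contract_edge G u v)) (vset (contract_edge G u v))
           (\<lambda>j. (\<lambda>x. if x = v then u else x) ` b j)"
proof -
  define h where "h = (\<lambda>x. if x = v then u else x)"
  have C: "vset (contract_edge G u v) = h ` vset G"
    "eset (contract_edge G u v) = {h ` e | e. e \<in> eset G \<and> e \<noteq> {u, v}}"
    unfolding contract_edge_def h_def by (simp_all add: Let_def)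
  have keep: "{h c, h d} \<in> eset (contract_edge G u v)" if "{c, d} \<in> eset G" "h c \<noteq> h d" for c d
  proof -
    have "{c, d} \<noteq> {u, v}" using that(2) by (auto simp: h_def doubleton_eq_iff)
    then show ?thesis unfolding C using that(1) by (smt (verit) image_empty image_insert mem_Collect_eq)
  qed
  have disj: "h ` b j \<inter> h ` b l = {}" if "j < 4" "l < 4" "j \<noteq> l" for j l
  proof -
    have d: "b j \<inter> b l = {}" "j \<noteq> i \<longrightarrow> b j \<inter> b i = {}" "l \<noteq> i \<longrightarrow> b l \<inter> b i = {}"
      using m that i unfolding K4_model_def by blast+
    have "j \<noteq> i \<or> l \<noteq> i" using that by auto
    then show ?thesis using d i unfolding h_def by (auto split: if_splits)
  qed
  moreover have "touches (eset (contract_edge G u v)) (h ` b j) (h ` b l)" if jl: "j < 4" "l < 4" "j \<noteq> l" for j l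
  proof -
    obtain c d where cd: "c \<in> b j" "d \<in> b l" "{c, d} \<in> eset G" using m jl unfolding K4_model_def touches_def by meson
    then have "h c \<noteq> h d" using disj[OF jl] by blast
    then show ?thesis using keep cd unfolding touches_def by blast
  qed
  moreover have "connected_in (eset (contract_edge G u v)) (h ` b j)" if "j < 4" for j
    by (rule connected_map[of "eset G"]) (use m that keep in \<open>auto simp: K4_model_def\<close>)
  moreover have "h ` b j \<subseteq> h ` vset G" if "j < 4" for j using m that unfolding K4_model_def by blast
  ultimately show ?thesis unfolding K4_model_def C(1) h_def[symmetric] by simp
qed

lemma simple_graph_contract:
  assumes "simple_graph G" "u \<in> vset G" 
  shows "simple_graph (contract_edge G u v)"
proof -
  define h where "h = (\<lambda>x. if x = v then u else x)"
  have "card (h ` e) = 2 \<and> h ` e \<subseteq> h ` vset G" if e: "e \<in> eset G" "e \<noteq> {u, v}" for e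
  proof -
    have "e \<subseteq> vset G" "card e = 2" using assms e by (auto simp: simple_graph_def)
    moreover have "inj_on h e"
    proof -
      obtain c d where "e = {c, d}" "c \<noteq> d" using \<open>card e = 2\<close> by (auto simp: card_2_iff)
      then show ?thesis using e by (auto simp: h_def inj_on_def)
    qed
    ultimately show ?thesis by (metis card_image image_mono)
  qed
  then show ?thesis
    using assms unfolding simple_graph_def contract_edge_def h_def[symmetric] by (auto simp: Let_def)
qed

text \<open>A vertex outside the branch sets is deleted, an edge inside a branch set contracted.
  Each step lowers the number of vertices, until singletons cover the graph.\<close>

lemma K4_minor_if_model:
  assumes "simple_graph G" "K4_model (eset G) (vset G) b"
  shows "\<exists>H. minor_step\<^sup>*\<^sup>* G H \<and> graph_iso H (complete_graph 4)"
  using assms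
proof (induction "card (vset G)" arbitrary: G b rule: less_induct)
  case less
  note G = less.prems(1) and m = less.prems(2)
  have fin: "finite (vset G)" using G by (simp add: simple_graph_def)
  have step: ?case if "minor_step G G'" "simple_graph G'" "K4_model (eset G') (vset G') b'"
    "card (vset G') < card (vset G)" for G' b'
    using less.hyps[OF that(4,2,3)] that(1) by (meson converse_rtranclp_into_rtranclp)
  show ?case
  proof (cases "vset G \<subseteq> (\<Union>i<4. b i)")
    case False
    then obtain z where z: "z \<in> vset G" "z \<notin> (\<Union>i<4. b i)" by blast
    have "simple_graph (delete_vertices G {z})"
      using G by (auto simp: simple_graph_def delete_vertices_def)
    moreover have "card (vset (delete_vertices G {z})) < card (vset G)"
      using card_Diff1_less[OF fin z(1)] by (simp add: delete_vertices_def)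
    ultimately show ?thesis
      using step minor_step.delete_vertex[OF z(1)] K4_model_delete_vertex[OF m z(2)] by blast
  next
    case cover: True
    show ?thesis
    proof (cases "\<forall>i<4. card (b i) \<le> 1")
      case True
      then show ?thesis using K4_minor_if_singletons[OF G m cover] by blast
    next
      case False
      then obtain i where i: "i < 4" "\<not> card (b i) \<le> 1" by blast
      have conn: "connected_in (eset G) (b i)" and sub: "b i \<subseteq> vset G"
        using m i by (auto simp: K4_model_def)
      obtain a where a: "a \<in> b i" using conn by (auto simp: connected_in_def)
      obtain a' where a': "a' \<in> b i" "a' \<noteq> a"
        using i(2) a by (metis card.empty card_1_singleton_iff eq_iff is_singletonI' is_singleton_altdef le_cases le_zero_eq)
      obtain c where c: "linked (eset G) (b i - {a}) a' c" "{c, a} \<in> eset G"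
        using linked_first_hit[OF connected_in_linked[OF conn a'(1) a] a'(2)] by blast
      then have "c \<in> b i" "c \<noteq> a" using linked_in by fast+
      have "simple_graph (contract_edge G c a)" using simple_graph_contract[OF G] \<open>c \<in> b i\<close> sub by blast
      moreover have "card (vset (contract_edge G c a)) < card (vset G)"
      proof -
        have "vset (contract_edge G c a) \<subseteq> vset G - {a}"
          using \<open>c \<in> b i\<close> sub \<open>c \<noteq> a\<close> by (auto simp: contract_edge_def Let_def)
        moreover have "a \<in> vset G" using a sub by blast
        ultimately show ?thesis using fin by (metis card_Diff1_less card_mono finite_Diff le_less_trans)
      qed
      ultimately show ?thesis
        using step[OF minor_step.contract[OF c(2)] _ K4_model_contract[OF m i(1) \<open>c \<in> b i\<close> a \<open>c \<noteq> a\<close>]] by simp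
    qed
  qed
qed

text \<open>The induction absorbs into \<open>X\<close> everything of \<open>W\<close> that a cut vertex \<open>p\<close> next to \<open>X\<close> leaves
  outside a component \<open>D\<close> touching both sides; if that part touched \<open>Y\<close>, it would form a
  \<open>K\<^sub>4\<close> model with \<open>X\<close>, \<open>Y\<close> and \<open>D\<close>.\<close>

lemma separating_vertex:
  assumes "finite W" "connected_in E X" "connected_in E Y" "connected_in E W"
    "X \<union> Y \<union> W \<subseteq> V" "X \<inter> Y = {}" "X \<inter> W = {}" "Y \<inter> W = {}"
    "touches E X Y" "touches E W X" "touches E W Y" "\<And>b. \<not> K4_model E V b"
  shows "\<exists>v\<in>W. \<forall>D\<in>parts E (W - {v}). \<not> (touches E D X \<and> touches E D Y)"
  using assms(1-11)
proof (induction "card W" arbitrary: W X rule: less_induct)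
  case less
  obtain p where p: "p \<in> W" "touches E {p} X" using less.prems by (auto simp: touches_def)
  show ?case
  proof (cases "\<forall>D\<in>parts E (W - {p}). \<not> (touches E D X \<and> touches E D Y)")
    case True
    then show ?thesis using p by blast
  next
    case False
    then obtain D where D: "D \<in> parts E (W - {p})" "touches E D X" "touches E D Y" by blast
    have DW: "D \<subseteq> W - {p}" using parts_subset[OF D(1)] .
    have conD: "connected_in E D" using parts_connected[OF D(1)] .
    define A where "A = W - D"
    have pA: "p \<in> A" using p DW by (auto simp: A_def)
    have conA: "connected_in E A" unfolding A_def using connected_Diff_part[OF \<open>connected_in E W\<close> p(1) D(1)] .
    have AX: "touches E A X" using p(2) pA by (auto simp: touches_def)
    have AD: "touches E A D"
      using part_touches[OF \<open>connected_in E W\<close> p(1) D(1)] pA touches_sym[of E A D]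
        touches_mono[of E D "{p}" D A] by auto
    have nAY: "\<not> touches E A Y"
    proof
      assume "touches E A Y"
      then have "K4_model E V (\<lambda>i. if i = 0 then X else if i = 1 then Y else if i = 2 then A else D)"
        using less.prems DW p conA conD AX AD D touches_sym[of E]
        by (intro K4_modelI) (auto simp: A_def)
      then show False using assms(12) by blast
    qed
    have cXA: "connected_in E (X \<union> A)"
      using connected_Un_edge[OF \<open>connected_in E X\<close> conA] AX touches_sym[of E A X] by simp
    have "\<exists>v\<in>D. \<forall>K\<in>parts E (D - {v}). \<not> (touches E K (X \<union> A) \<and> touches E K Y)"
    proof (rule less.hyps)
      show "card D < card W" using DW p less.prems(1) by (metis Diff_subset card_Diff1_less card_mono finite_Diff le_less_trans)
      show "finite D" using DW less.prems(1) by (meson Diff_subset finite_subset)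
      show "touches E D (X \<union> A)" using D(2) touches_mono[of E D X D "X \<union> A"] by auto
      show "touches E (X \<union> A) Y" using less.prems touches_mono[of E X Y "X \<union> A" Y] by auto
    qed (use less.prems DW D conD cXA in \<open>auto simp: A_def\<close>)
    then obtain v where v: "v \<in> D" "\<forall>K\<in>parts E (D - {v}). \<not> (touches E K (X \<union> A) \<and> touches E K Y)" by blast
    have "\<not> (touches E K X \<and> touches E K Y)" if K: "K \<in> parts E (W - {v})" for K
    proof
      assume t: "touches E K X \<and> touches E K Y"
      \<comment> \<open>The neighbour \<open>b\<close> of \<open>Y\<close> lies in \<open>D\<close>,
        as \<open>A\<close> does not touch \<open>Y\<close>. Its component in \<open>D - {v}\<close>
        touches \<open>Y\<close>, hence not \<open>A\<close>, so it is already closed in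
        \<open>W - {v}\<close> and is all of \<open>K\<close>.\<close>
      then obtain b where b: "b \<in> K" "touches E {b} Y" by (auto simp: touches_def)
      have "b \<notin> A" using nAY b(2) touches_mono[of E "{b}" Y A Y] by auto
      then have "b \<in> D - {v}" using b(1) parts_subset[OF K] by (auto simp: A_def)
      then obtain K' where K': "K' \<in> parts E (D - {v})" "b \<in> K'" using parts_cover by metis
      have "touches E K' Y" using b(2) K'(2) touches_mono[of E "{b}" Y K' Y] by auto
      then have n: "\<not> touches E K' (X \<union> A)" using v(2) K'(1) by blast
      have K's: "K' \<subseteq> D - {v}" using parts_subset[OF K'(1)] .
      have "K' \<in> parts E (W - {v})"
      proof (rule connected_partsI)
        show "connected_in E K'" using parts_connected[OF K'(1)] .
        show "K' \<subseteq> W - {v}" using K's DW by auto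
        fix c d assume cd: "c \<in> K'" "d \<in> W - {v}" "{c, d} \<in> E"
        then have "d \<notin> A" using n by (auto simp: touches_def)
        then have "d \<in> D - {v}" using cd by (auto simp: A_def)
        then show "d \<in> K'" using parts_closed[OF K'(1)] cd by blast
      qed
      then have "K' = K" using parts_disjoint K b(1) K'(2) by metis
      then show False using n t touches_mono[of E K X K "X \<union> A"] by auto
    qed
    then show ?thesis using v(1) DW by blast
  qed
qed

section \<open>Bounded edge sets on pieces\<close>

definition edge_deg :: "'a set set \<Rightarrow> 'a \<Rightarrow> nat" where
  "edge_deg E v = card {e \<in> E. v \<in> e}"

text \<open>The nontrivial bridges counted by \<open>c(G, uv)\<close>, represented by their vertex
  sets without \<open>u\<close> and \<open>v\<close>; see \<open>num_bridges_eq\<close>.\<close>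

definition common_parts :: "'a set set \<Rightarrow> 'a set \<Rightarrow> 'a \<Rightarrow> 'a \<Rightarrow> 'a set set" where
  "common_parts E V u v = {K \<in> parts E (V - {u, v}). touches E K {u} \<and> touches E K {v}}"

lemma common_parts_commute: "common_parts E V u v = common_parts E V v u"
  by (auto simp: common_parts_def insert_commute)

lemma edge_deg_Un: "edge_deg (A \<union> B) v \<le> edge_deg A v + edge_deg B v"
proof -
  have "{e \<in> A \<union> B. v \<in> e} = {e \<in> A. v \<in> e} \<union> {e \<in> B. v \<in> e}" by auto
  then show ?thesis unfolding edge_deg_def by (metis card_Un_le)
qed

lemma edge_deg_Un_left: "v \<notin> \<Union>B \<Longrightarrow> edge_deg (A \<union> B) v = edge_deg A v"
  unfolding edge_deg_def by (rule arg_cong[where f = card]) auto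

lemma edge_deg_mono: "finite B \<Longrightarrow> A \<subseteq> B \<Longrightarrow> edge_deg A v \<le> edge_deg B v"
  unfolding edge_deg_def by (rule card_mono) auto

lemma edge_deg_Diff: "finite A \<Longrightarrow> e \<in> A \<Longrightarrow> v \<in> e \<Longrightarrow> edge_deg A v = Suc (edge_deg (A - {e}) v)"
proof -
  assume "finite A" "e \<in> A" "v \<in> e"
  then have "{f \<in> A - {e}. v \<in> f} = {f \<in> A. v \<in> f} - {e}" by auto
  then show ?thesis unfolding edge_deg_def
    using \<open>finite A\<close> \<open>e \<in> A\<close> \<open>v \<in> e\<close> card.remove[of "{f \<in> A. v \<in> f}" e] by simp
qed

text \<open>The edge is the last one of a path from \<open>v\<close> to its first visit of \<open>x\<close>.\<close>

lemma removable_edge: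
  assumes "linked E UNIV x v" "x \<noteq> v"
  shows "\<exists>e\<in>E. x \<in> e \<and>
    (\<forall>a. linked E UNIV a x \<longrightarrow> linked (E - {e}) UNIV a x \<or> linked (E - {e}) UNIV a v)"
proof -
  obtain z where z: "linked E (UNIV - {x}) v z" "{z, x} \<in> E"
    using linked_first_hit[OF linked_sym[OF assms(1)]] assms(2) by blast
  let ?e = "{z, x}"
  have zv: "linked (E - {?e}) UNIV z v" using linked_sym[OF linked_Diff_edge[OF z(1), of ?e]] by simp
  \<comment> \<open>Stop a walk from \<open>a\<close> before its first visit of \<open>x\<close>. If
    it is about to enter \<open>x\<close> from a vertex other than \<open>z\<close>, it survives the
    removal; if it stops at \<open>z\<close>, it continues to \<open>v\<close>.\<close>
  have "linked (E - {?e}) UNIV a x \<or> linked (E - {?e}) UNIV a v" if a: "linked E UNIV a x" for a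
  proof (cases "a = x")
    case True then show ?thesis by (simp add: linked_refl)
  next
    case False
    then obtain y where y: "linked E (UNIV - {x}) a y" "{y, x} \<in> E" using linked_first_hit[OF a] by blast
    then have ay: "linked (E - {?e}) UNIV a y" "y \<noteq> x" using linked_Diff_edge[OF y(1), of ?e] linked_in[OF y(1)] by auto
    show ?thesis
    proof (cases "y = z")
      case True
      then show ?thesis using linked_trans[OF zv] ay by blast
    next
      case False
      then have "{y, x} \<in> E - {?e}" using y(2) by (auto simp: doubleton_eq_iff)
      then show ?thesis using linked_step[OF ay(1), of x] by blast
    qed
  qed
  then show ?thesis using z(2) by blast
qed

lemma parts_insert_disjoint:
  assumes "insert K \<K> \<subseteq> parts E A" "K \<notin> \<K>"
  shows "\<Union>\<K> \<inter> K = {}"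
proof -
  have "K' = K" if "a \<in> K'" "K' \<in> \<K>" "a \<in> K" for a K'
    using parts_disjoint[of K' E A K a] that assms(1) by auto
  then show ?thesis using assms(2) by blast
qed

text \<open>Every vertex at which a walk leaves \<open>W\<close> is reachable from \<open>x\<close>
  without \<open>W\<close>, so each excursion into \<open>W\<close> can be bypassed.\<close>

lemma linked_from_outside:
  assumes "linked E V x a" "x \<notin> W" "\<And>b c. b \<in> W \<Longrightarrow> c \<in> V - W \<Longrightarrow> {b, c} \<in> E \<Longrightarrow> linked E (V - W) x c"
  shows "a \<in> W \<or> linked E (V - W) x a"
  using assms
proof (induction rule: linked.induct)
  case (linked_step a b c)
  then show ?case using linked_step.prems(2)[of b c] linked.linked_step[of E "V - W" a b c] linked_in[of E V a b] by blast
qed (auto intro: linked_refl)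

text \<open>\<open>C\<close> is the set of pairs \<open>(r\<^sub>i, s\<^sub>i)\<close>, \<open>\<rho>\<close> is \<open>r\<^sub>0\<close>, and \<open>w u v\<close> is \<open>\<omega>({u, v}, u)\<close>,
  or 0 if \<open>{u, v}\<close> is not a nontrivial 2-cut. The assumption \<open>chosen_ex1\<close> is all that the core of
  the argument needs to know about blocks.\<close>

locale rooted_graph =
  fixes V :: "'a set" and E :: "'a set set" and \<rho> :: 'a and C :: "('a \<times> 'a) set"
    and w :: "'a \<Rightarrow> 'a \<Rightarrow> nat"
  assumes finite_V: "finite V"
    and edges: "e \<in> E \<Longrightarrow> e \<subseteq> V \<and> card e = 2"
    and connected: "connected_in E V"
    and no_K4: "\<not> K4_model E V b"
    and root: "\<rho> \<in> V"
    and chosen: "(u, t) \<in> C \<Longrightarrow>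
      {u, t} \<in> E \<and> card (common_parts E V u t) \<le> 1 \<and> \<not> linked E (V - {u}) t \<rho>"
    and chosen_ex1: "u \<in> V \<Longrightarrow> Y \<in> parts E (V - {u}) \<Longrightarrow> \<rho> \<notin> Y \<Longrightarrow> \<exists>!t. t \<in> Y \<and> (u, t) \<in> C"
    and weight: "u \<in> V \<Longrightarrow> v \<in> V \<Longrightarrow> u \<noteq> v \<Longrightarrow> 3 \<le> card (common_parts E V u v) \<Longrightarrow>
      card (common_parts E V u v) \<le> w u v + w v u + 2"
begin

text \<open>By \<open>chosen\<close> the count is at most 1, so these are the edges
  \<open>r_i s_i\<close> with \<open>c(G, r_i s_i) = 1\<close>.\<close>

definition forbidden :: "'a set set" where
  "forbidden = {{u, t} | u t. (u, t) \<in> C \<and> common_parts E V u t \<noteq> {}}"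

text \<open>For \<open>A = V\<close> this is the total weight at \<open>u\<close> over all
  nontrivial 2-cuts containing \<open>u\<close>; a smaller \<open>A\<close> gives the share that a
  piece may spend.\<close>

definition wsum :: "'a \<Rightarrow> 'a set \<Rightarrow> nat" where
  "wsum u A = (\<Sum>a\<in>A. w u a)"

text \<open>The right-hand side will be at most \<open>f(u)\<close>, the number of parts being
  \<open>c(G - u)\<close>. The 1 on the left is the saving required at \<open>s_i\<close>; the one
  at \<open>r_0\<close> is recorded separately in \<open>bounded_spanning_set\<close>.\<close>

definition bounded :: "'a set set \<Rightarrow> 'a \<Rightarrow> bool" where
  "bounded E' u \<longleftrightarrow> edge_deg E' u + (if u \<in> snd ` C then 1 else 0)
     \<le> wsum u V + card (parts E (V - {u})) + 1"

text \<open>Vertices of \<open>I\<close> are interior: their degree is final. Those of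
  \<open>R\<close> are terminals, whose degree still accumulates over several pieces.\<close>

definition admissible :: "'a set set \<Rightarrow> 'a set \<Rightarrow> 'a set \<Rightarrow> bool" where
  "admissible E' I R \<longleftrightarrow> E' \<subseteq> E - forbidden \<and> \<Union>E' \<subseteq> I \<union> R \<and> (\<forall>a\<in>I. bounded E' a)"

text \<open>The link outside \<open>W\<close> supplies the adjacency of two branch sets in the
  \<open>K4\<close> argument and the additional bridge in the count \<open>p + 1\<close>. The last
  condition lets an edge from a terminal into \<open>W\<close> be used, and helps to show that a
  splitting vertex is no \<open>s_i\<close>.\<close>

definition piece2 :: "'a \<Rightarrow> 'a \<Rightarrow> 'a set \<Rightarrow> bool" where
  "piece2 x y W \<longleftrightarrow> x \<noteq> y \<and> x \<in> V \<and> y \<in> V \<and> W \<in> parts E (V - {x, y}) \<and>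
     touches E W {x} \<and> touches E W {y} \<and> linked E (V - W) x y \<and> \<rho> \<notin> W \<and>
     (\<forall>t\<in>W. (x, t) \<notin> C \<and> (y, t) \<notin> C)"

definition piece1 :: "'a \<Rightarrow> 'a set \<Rightarrow> bool" where
  "piece1 v Y \<longleftrightarrow> v \<in> V \<and> Y \<in> parts E (V - {v}) \<and> \<rho> \<notin> Y"

definition solves2 :: "'a \<Rightarrow> 'a \<Rightarrow> 'a set \<Rightarrow> 'a set set \<Rightarrow> bool" where
  "solves2 x y W E' \<longleftrightarrow> admissible E' W {x, y} \<and> (\<forall>a\<in>insert y W. linked E' UNIV a x) \<and>
     edge_deg E' x \<le> 1 + wsum x W \<and> edge_deg E' y \<le> 1 + wsum y W"

definition solves1 :: "'a \<Rightarrow> 'a set \<Rightarrow> 'a set set \<Rightarrow> bool" where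
  "solves1 v Y E' \<longleftrightarrow> admissible E' Y {v} \<and> (\<forall>a\<in>Y. linked E' UNIV a v) \<and>
     edge_deg E' v \<le> 1 + wsum v Y"

lemma finite_E: "finite E"
proof (rule finite_subset)
  show "E \<subseteq> Pow V" using edges by auto
qed (use finite_V in auto)

lemma edge_ends: "{a, b} \<in> E \<Longrightarrow> a \<in> V \<and> b \<in> V \<and> a \<noteq> b"
  using edges[of "{a, b}"] by auto

lemma finite_parts_V: "finite (parts E (V - S))"
  using finite_parts finite_V by auto

lemma finite_Union_parts: "\<K> \<subseteq> parts E (V - S) \<Longrightarrow> finite (\<Union>\<K>)"
proof (rule finite_subset)
  show "\<K> \<subseteq> parts E (V - S) \<Longrightarrow> \<Union>\<K> \<subseteq> V" using parts_subset[of _ E "V - S"] by blast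
qed (rule finite_V)

lemma finite_part: "K \<in> parts E (V - S) \<Longrightarrow> finite K"
  using finite_Union_parts[of "{K}" S] by simp

lemma wsum_Un: "finite A \<Longrightarrow> finite B \<Longrightarrow> A \<inter> B = {} \<Longrightarrow> wsum u (A \<union> B) = wsum u A + wsum u B"
  by (simp add: wsum_def sum.union_disjoint)

lemma wsum_mono: "finite B \<Longrightarrow> A \<subseteq> B \<Longrightarrow> wsum u A \<le> wsum u B"
  unfolding wsum_def by (rule sum_mono2) auto

lemma bounded_mono: "bounded B a \<Longrightarrow> finite B \<Longrightarrow> A \<subseteq> B \<Longrightarrow> bounded A a"
  unfolding bounded_def using edge_deg_mono[of B A a] by linarith

lemma admissible_finite: "admissible E' I R \<Longrightarrow> finite E'"
  unfolding admissible_def using finite_E by (meson Diff_subset finite_subset)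

lemma admissible_mono: "admissible B I R \<Longrightarrow> A \<subseteq> B \<Longrightarrow> R \<subseteq> R' \<Longrightarrow> admissible A I R'"
  using bounded_mono admissible_finite unfolding admissible_def by blast

text \<open>An interior vertex of one edge set lies on no edge of the other, so its degree does not
  change.\<close>

lemma admissible_Un:
  assumes "admissible E1 I1 R" "admissible E2 I2 R" "I1 \<inter> I2 = {}" "I1 \<inter> R = {}" "I2 \<inter> R = {}"
  shows "admissible (E1 \<union> E2) (I1 \<union> I2) R"
proof -
  have "bounded (E1 \<union> E2) a" if "a \<in> I1 \<union> I2" for a
  proof (cases "a \<in> I1")
    case True
    then have "a \<notin> \<Union>E2" using assms unfolding admissible_def by blast
    then have "edge_deg (E1 \<union> E2) a = edge_deg E1 a" by (rule edge_deg_Un_left)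
    then show ?thesis using True assms(1) unfolding admissible_def bounded_def by simp
  next
    case False
    then have "a \<notin> \<Union>E1" using assms that unfolding admissible_def by blast
    then have "edge_deg (E1 \<union> E2) a = edge_deg E2 a" by (metis Un_commute edge_deg_Un_left)
    then show ?thesis using False that assms(2) unfolding admissible_def bounded_def by simp
  qed
  then show ?thesis using assms unfolding admissible_def by blast
qed

lemma admissible_interior:
  assumes "admissible E' I (insert t R)" "bounded E' t"
  shows "admissible E' (insert t I) R"
  using assms unfolding admissible_def by auto

text \<open>The pieces share only \<open>v\<close>, so the edge sets are united as they are; each
  costs \<open>v\<close> one edge beyond its weights.\<close>

lemma hang_pieces1:
  assumes "finite \<K>" "\<K> \<subseteq> parts E (V - {v})" "\<And>K. K \<in> \<K> \<Longrightarrow> \<exists>E'. solves1 v K E'"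
  shows "\<exists>E'. admissible E' (\<Union>\<K>) {v} \<and> (\<forall>a\<in>\<Union>\<K>. linked E' UNIV a v) \<and>
    edge_deg E' v \<le> card \<K> + wsum v (\<Union>\<K>)"
  using assms
proof (induction \<K>)
  case empty
  then show ?case by (intro exI[of _ "{}"]) (auto simp: admissible_def edge_deg_def)
next
  case (insert K \<K>)
  then obtain E1 where E1: "admissible E1 (\<Union>\<K>) {v}" "\<forall>a\<in>\<Union>\<K>. linked E1 UNIV a v"
    "edge_deg E1 v \<le> card \<K> + wsum v (\<Union>\<K>)" by auto
  obtain E2 where E2: "solves1 v K E2" using insert.prems by auto
  have fin: "finite K" "finite (\<Union>\<K>)"
    using insert.prems(1) finite_part finite_Union_parts[of \<K>] by auto
  have disj: "\<Union>\<K> \<inter> K = {}"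
    using parts_insert_disjoint insert.prems(1) insert.hyps(2) .
  have v: "v \<notin> K" "v \<notin> \<Union>\<K>" using insert.prems(1) parts_subset[of _ E "V - {v}"] by blast+
  have "admissible (E1 \<union> E2) (\<Union>\<K> \<union> K) {v}"
    using admissible_Un[of E1 "\<Union>\<K>" "{v}" E2 K] E1(1) E2 disj v unfolding solves1_def by simp
  moreover have "\<forall>a\<in>\<Union>\<K> \<union> K. linked (E1 \<union> E2) UNIV a v"
    using E1(2) E2 linked_mono[of E1 UNIV _ v "E1 \<union> E2"] linked_mono[of E2 UNIV _ v "E1 \<union> E2"]
    unfolding solves1_def by auto
  moreover have "edge_deg (E1 \<union> E2) v \<le> card (insert K \<K>) + wsum v (\<Union>\<K> \<union> K)"
    using edge_deg_Un[of E1 E2 v] E1(3) E2 insert.hyps wsum_Un[OF fin(2,1)] disj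
    unfolding solves1_def by (auto simp: Int_commute)
  ultimately show ?case by (intro exI[of _ "E1 \<union> E2"]) (simp add: Un_commute)
qed

text \<open>\<open>\<alpha>\<close> and \<open>\<beta>\<close> count the edges removed at \<open>x\<close> and at \<open>v\<close>.\<close>

lemma glue_pieces2:
  assumes "finite \<Z>" "\<Z> \<noteq> {}" "x \<noteq> v" "\<Z> \<subseteq> parts E (V - {x, v})"
    "\<And>Z. Z \<in> \<Z> \<Longrightarrow> \<exists>E'. solves2 x v Z E'" "\<alpha> + \<beta> + 1 = card \<Z>"
  shows "\<exists>E'. admissible E' (\<Union>\<Z>) {x, v} \<and> (\<forall>a\<in>insert v (\<Union>\<Z>). linked E' UNIV a x) \<and>
    edge_deg E' x + \<alpha> \<le> card \<Z> + wsum x (\<Union>\<Z>) \<and> edge_deg E' v + \<beta> \<le> card \<Z> + wsum v (\<Union>\<Z>)"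
  using assms(1,2,4-)
proof (induction \<Z> arbitrary: \<alpha> \<beta> rule: finite_ne_induct)
  case (singleton Z)
  then obtain E' where "solves2 x v Z E'" by auto
  then show ?case using singleton by (intro exI[of _ E']) (auto simp: solves2_def)
next
  case (insert Z \<Z>)
  have fin: "finite Z" "finite (\<Union>\<Z>)"
    using insert.prems(1) finite_part finite_Union_parts[of \<Z>] by auto
  have disj: "\<Union>\<Z> \<inter> Z = {}"
    using parts_insert_disjoint insert.prems(1) insert.hyps(3) .
  have xv: "\<Union>\<Z> \<inter> {x, v} = {}" "Z \<inter> {x, v} = {}"
    using insert.prems(1) parts_subset[of _ E "V - {x, v}"] by blast+
  obtain E2 where "solves2 x v Z E2" using insert.prems by auto
  then have E2: "admissible E2 Z {x, v}" "\<And>a. a \<in> insert v Z \<Longrightarrow> linked E2 UNIV a x"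
    "edge_deg E2 x \<le> 1 + wsum x Z" "edge_deg E2 v \<le> 1 + wsum v Z" by (auto simp: solves2_def)
  have finE2: "finite E2" using admissible_finite E2(1) .
  have card: "card (insert Z \<Z>) = Suc (card \<Z>)" using insert by simp
  \<comment> \<open>The pieces treated so far already join \<open>x\<close> to \<open>v\<close>. The
    new piece may therefore lose an edge \<open>e\<close>, as long as each of its vertices still
    reaches one of the two.\<close>
  have step: ?case
    if E1: "admissible E1 (\<Union>\<Z>) {x, v}" "\<And>a. a \<in> insert v (\<Union>\<Z>) \<Longrightarrow> linked E1 UNIV a x"
      and ab: "edge_deg E1 x + edge_deg (E2 - {e}) x + \<alpha> \<le> Suc (card \<Z>) + wsum x Z + wsum x (\<Union>\<Z>)"
        "edge_deg E1 v + edge_deg (E2 - {e}) v + \<beta> \<le> Suc (card \<Z>) + wsum v Z + wsum v (\<Union>\<Z>)"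
      and e: "\<And>a. a \<in> Z \<Longrightarrow> linked (E2 - {e}) UNIV a x \<or> linked (E2 - {e}) UNIV a v"
    for E1 e
  proof -
    let ?E' = "E1 \<union> (E2 - {e})"
    have "admissible ?E' (\<Union>\<Z> \<union> Z) {x, v}"
      using admissible_Un[OF E1(1) admissible_mono[OF E2(1)] disj xv] by blast
    moreover have "linked ?E' UNIV a x" if "a \<in> insert v (\<Union>\<Z> \<union> Z)" for a
    proof -
      have l1: "linked ?E' UNIV b x" if "b \<in> insert v (\<Union>\<Z>)" for b
        using linked_mono[OF E1(2)[OF that]] by auto
      show ?thesis
      proof (cases "a \<in> Z")
        case True
        then have "linked ?E' UNIV a x \<or> linked ?E' UNIV a v"
          using e[OF True] linked_mono[of "E2 - {e}" UNIV a _ ?E' UNIV] by auto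
        then show ?thesis using l1[of v] linked_trans[of ?E' UNIV v x a] by auto
      qed (use that l1 in auto)
    qed
    moreover have "edge_deg ?E' x + \<alpha> \<le> card (insert Z \<Z>) + wsum x (\<Union>\<Z> \<union> Z)"
      using ab(1) edge_deg_Un[of E1 "E2 - {e}" x] wsum_Un[OF fin(2,1) disj] card by simp
    moreover have "edge_deg ?E' v + \<beta> \<le> card (insert Z \<Z>) + wsum v (\<Union>\<Z> \<union> Z)"
      using ab(2) edge_deg_Un[of E1 "E2 - {e}" v] wsum_Un[OF fin(2,1) disj] card by simp
    ultimately show ?thesis by (intro exI[of _ ?E']) (simp add: Un_commute)
  qed
  have dv: "edge_deg (E2 - {e}) b \<le> edge_deg E2 b" for e b using edge_deg_mono[OF finE2] by blast
  \<comment> \<open>Some removal is still to be made, at \<open>x\<close> or at \<open>v\<close>; it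
    is assigned to the new piece and the others to the earlier ones.\<close>
  have "\<alpha> + \<beta> = card \<Z>" "card \<Z> > 0" using insert card by (auto simp: card_gt_0_iff)
  then consider \<alpha>' where "\<alpha> = Suc \<alpha>'" "\<alpha>' + \<beta> + 1 = card \<Z>" | \<beta>' where "\<beta> = Suc \<beta>'" "\<alpha> + \<beta>' + 1 = card \<Z>"
    by (cases \<alpha>; cases \<beta>) auto
  then show ?case
  proof cases
    case 1
    obtain E1 where E1: "admissible E1 (\<Union>\<Z>) {x, v}" "\<forall>a\<in>insert v (\<Union>\<Z>). linked E1 UNIV a x"
      "edge_deg E1 x + \<alpha>' \<le> card \<Z> + wsum x (\<Union>\<Z>)" "edge_deg E1 v + \<beta> \<le> card \<Z> + wsum v (\<Union>\<Z>)"
      using insert.IH[of \<alpha>' \<beta>] insert.prems 1 by auto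
    obtain e where e: "e \<in> E2" "x \<in> e"
      "\<forall>a. linked E2 UNIV a x \<longrightarrow> linked (E2 - {e}) UNIV a x \<or> linked (E2 - {e}) UNIV a v"
      using removable_edge[OF linked_sym[OF E2(2)[of v]]] assms(3) by auto
    show ?thesis
      using E1 e E2 dv[of e v] edge_deg_Diff[OF finE2 e(1,2)] 1 by (intro step[of E1 e]) auto
  next
    case 2
    obtain E1 where E1: "admissible E1 (\<Union>\<Z>) {x, v}" "\<forall>a\<in>insert v (\<Union>\<Z>). linked E1 UNIV a x"
      "edge_deg E1 x + \<alpha> \<le> card \<Z> + wsum x (\<Union>\<Z>)" "edge_deg E1 v + \<beta>' \<le> card \<Z> + wsum v (\<Union>\<Z>)"
      using insert.IH[of \<alpha> \<beta>'] insert.prems 2 by auto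
    obtain e where e: "e \<in> E2" "v \<in> e"
      "\<forall>a. linked E2 UNIV a v \<longrightarrow> linked (E2 - {e}) UNIV a v \<or> linked (E2 - {e}) UNIV a x"
      using removable_edge[OF E2(2)[of v]] assms(3) by auto
    have av: "linked E2 UNIV a v" if "a \<in> Z" for a
      using linked_trans[OF linked_sym[OF E2(2)[of v]] E2(2)[of a]] that by auto
    show ?thesis
      using E1 e E2 av dv[of e x] edge_deg_Diff[OF finE2 e(1,2)] 2 by (intro step[of E1 e]) auto
  qed
qed

text \<open>The bridge \<open>K\<close> outside \<open>\<Z>\<close> forces \<open>c(G, xv)\<close>
  to exceed the number of pieces, which makes the weights of \<open>{x, v}\<close> large enough.
  These weights enter the bounds through the inserted vertices.\<close>

lemma two_terminal:
  assumes "x \<noteq> v" "x \<in> V" "v \<in> V" "\<Z> \<subseteq> common_parts E V x v" "K \<in> common_parts E V x v" "K \<notin> \<Z>"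
    "\<And>Z. Z \<in> \<Z> \<Longrightarrow> \<exists>E'. solves2 x v Z E'" "\<Z> = {} \<Longrightarrow> {x, v} \<in> E - forbidden"
  shows "\<exists>E'. admissible E' (\<Union>\<Z>) {x, v} \<and> (\<forall>a\<in>insert v (\<Union>\<Z>). linked E' UNIV a x) \<and>
    edge_deg E' x \<le> 1 + wsum x (insert v (\<Union>\<Z>)) \<and> edge_deg E' v \<le> 1 + wsum v (insert x (\<Union>\<Z>))"
proof -
  have parts: "\<Z> \<subseteq> parts E (V - {x, v})" using assms(4) by (auto simp: common_parts_def)
  have fincp: "finite (common_parts E V x v)" using finite_parts_V by (simp add: common_parts_def)
  have fin: "finite \<Z>" using fincp assms(4) finite_subset by blast
  have finU: "finite (\<Union>\<Z>)" and out: "x \<notin> \<Union>\<Z>" "v \<notin> \<Union>\<Z>"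
    using finite_Union_parts[OF parts] parts parts_subset[of _ E "V - {x, v}"] by blast+
  have ws: "wsum x (insert v (\<Union>\<Z>)) = w x v + wsum x (\<Union>\<Z>)" "wsum v (insert x (\<Union>\<Z>)) = w v x + wsum v (\<Union>\<Z>)"
    using finU out by (simp_all add: wsum_def)
  show ?thesis
  proof (cases "\<Z> = {}")
    case True
    have "{x, v} \<in> E - forbidden" using assms(8) True .
    moreover have "edge_deg {{x, v}} b \<le> 1" for b by (simp add: edge_deg_def card_le_Suc0_iff_eq)
    moreover have "linked {{x, v}} UNIV v x" by (rule linked_edge) auto
    ultimately show ?thesis using True by (intro exI[of _ "{{x, v}}"]) (auto simp: admissible_def intro: le_trans)
  next
    case False
    have "card (insert K \<Z>) \<le> card (common_parts E V x v)"
      using assms(4,5) fincp by (intro card_mono) auto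
    then have c: "Suc (card \<Z>) \<le> card (common_parts E V x v)" using assms(6) fin by simp
    have c0: "card \<Z> > 0" using False fin by (simp add: card_gt_0_iff)
    \<comment> \<open>Two pieces together with \<open>K\<close> make \<open>{x, v}\<close> a
      nontrivial 2-cut, so \<open>weight\<close> applies; a single piece needs no removal.\<close>
    have c2: "card \<Z> \<le> w x v + w v x + 1"
    proof (cases "card \<Z> \<ge> 2")
      case True
      then show ?thesis using weight[OF assms(2,3,1)] c by linarith
    qed simp
    \<comment> \<open>The bounds are crossed on purpose: after \<alpha> removals at
      \<open>x\<close>, the pieces leave \<open>card \<Z> - \<alpha> = \<beta> + 1\<close> edges
      there beyond their own weights, and \<open>1 + w x v\<close> has to pay for them.\<close>
    obtain \<alpha> \<beta> where ab: "\<alpha> + \<beta> + 1 = card \<Z>" "\<alpha> \<le> w v x" "\<beta> \<le> w x v"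
    proof
      show "min (card \<Z> - 1) (w v x) + (card \<Z> - 1 - min (card \<Z> - 1) (w v x)) + 1 = card \<Z>" using c0 by simp
    qed (use c2 in auto)
    obtain E' where E': "admissible E' (\<Union>\<Z>) {x, v}" "\<forall>a\<in>insert v (\<Union>\<Z>). linked E' UNIV a x"
      "edge_deg E' x + \<alpha> \<le> card \<Z> + wsum x (\<Union>\<Z>)" "edge_deg E' v + \<beta> \<le> card \<Z> + wsum v (\<Union>\<Z>)"
      using glue_pieces2[OF fin False assms(1) parts assms(7) ab(1)] by blast
    have "edge_deg E' x \<le> 1 + wsum x (insert v (\<Union>\<Z>))" "edge_deg E' v \<le> 1 + wsum v (insert x (\<Union>\<Z>))"
      using E'(3,4) ab ws by linarith+
    then show ?thesis using E'(1,2) by blast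
  qed
qed

section \<open>Pieces between two terminals\<close>

lemma piece2_sym: "piece2 x y W \<Longrightarrow> piece2 y x W"
  unfolding piece2_def using linked_sym by (metis insert_commute)

lemma piece2_nbr: "piece2 x y W \<Longrightarrow> a \<in> W \<Longrightarrow> {a, b} \<in> E \<Longrightarrow> b \<in> W \<or> b = x \<or> b = y"
  unfolding piece2_def using parts_closed[of W E "V - {x, y}" a b] edge_ends[of a b] by blast

lemma piece2_subset: "piece2 x y W \<Longrightarrow> W \<subseteq> V - {x, y}"
  unfolding piece2_def using parts_subset by blast

text \<open>Outside \<open>W\<close>, only \<open>x\<close> and \<open>y\<close> have neighbours in
  \<open>W\<close>, and they are linked without it, so excursions into \<open>W\<close> can be
  replaced.\<close>

lemma piece2_outside: 
  assumes p: "piece2 x y W" and "a \<in> V - W"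
  shows "linked E (V - W) x a"
proof -
  have x: "x \<in> V" "x \<notin> W" using p piece2_subset[OF p] by (auto simp: piece2_def)
  have "a \<in> W \<or> linked E (V - W) x a"
  proof (rule linked_from_outside)
    show "linked E V x a" using connected_in_linked[OF connected] x assms by simp
    fix b c assume "b \<in> W" "c \<in> V - W" "{b, c} \<in> E"
    then have "c = x \<or> c = y" using piece2_nbr[OF p] by blast
    then show "linked E (V - W) x c" using p x linked_refl[of x "V - W" E] by (auto simp: piece2_def)
  qed (use x in simp)
  then show ?thesis using assms by simp
qed

text \<open>Against \<open>chosen\<close>, this rules out a pair \<open>(u, t)\<close> with
  \<open>u\<close> in the piece whenever \<open>t\<close> still reaches the terminal without
  \<open>u\<close>.\<close>

lemma piece2_root: 
  assumes p: "piece2 x y W" and u: "u \<in> W"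
  shows "linked E (V - {u}) x \<rho>"
proof -
  have "linked E (V - W) x \<rho>" using piece2_outside[OF p] p root by (simp add: piece2_def)
  then show ?thesis by (rule linked_mono) (use u in auto)
qed

text \<open>When \<open>W\<close> is connected and contains \<open>v\<close>, each component of
  \<open>W - {v}\<close> is adjacent to \<open>v\<close>; so these are the pieces between
  \<open>x\<close> and \<open>v\<close>.\<close>

definition side :: "'a \<Rightarrow> 'a \<Rightarrow> 'a set \<Rightarrow> 'a set set" where
  "side x v W = {D \<in> parts E (W - {v}). touches E D {x}}"

text \<open>An edge from \<open>x\<close> into \<open>W\<close> ends either in \<open>v\<close> or
  in a component of \<open>W - {v}\<close>, and that component is adjacent to
  \<open>v\<close>.\<close>

lemma side_linked:
  assumes p: "piece2 x y W" and v: "v \<in> W"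
  shows "linked E (insert v (insert x (\<Union>(side x v W)))) v x"
proof -
  let ?A = "insert v (insert x (\<Union>(side x v W)))"
  obtain b where b: "b \<in> W" "{b, x} \<in> E" using p by (auto simp: piece2_def touches_def)
  have con: "connected_in E W" using p parts_connected by (auto simp: piece2_def)
  show ?thesis
  proof (cases "b = v")
    case True
    then show ?thesis using b by (auto intro: linked_edge)
  next
    case False
    then obtain D where D: "D \<in> parts E (W - {v})" "b \<in> D" using b parts_cover[of b "W - {v}" E] by auto
    have Ds: "D \<in> side x v W" using D b unfolding side_def touches_def by auto
    have "connected_in E (D \<union> {v})"
      using connected_Un_edge[OF parts_connected[OF D(1)] connected_singleton part_touches[OF con v D(1)]] .
    then have "linked E (D \<union> {v}) v b" by (rule connected_in_linked) (use D in auto)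
    then have "linked E ?A v b" by (rule linked_mono) (use Ds in auto)
    then show ?thesis using b(2) by (rule linked_step) simp
  qed
qed

lemma side_subset: "\<Union>(side x v W) \<subseteq> W - {v}"
  using parts_subset[of _ E "W - {v}"] unfolding side_def by blast

lemma side_disjoint:
  assumes "\<forall>D\<in>parts E (W - {v}). \<not> (touches E D {x} \<and> touches E D {y})"
  shows "\<Union>(side x v W) \<inter> \<Union>(side y v W) = {}"
  using assms parts_disjoint[of _ E "W - {v}"] unfolding side_def by blast

text \<open>One half of the split, by \<open>two_terminal\<close>: the additional bridge is the
  component of \<open>y\<close>, and the edge \<open>xv\<close> serves when no piece lies between
  \<open>x\<close> and \<open>v\<close>. The other half follows by symmetry.\<close>

lemma piece2_side:
  assumes p: "piece2 x y W" and v: "v \<in> W"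
    and sep: "\<forall>D\<in>parts E (W - {v}). \<not> (touches E D {x} \<and> touches E D {y})"
    and IH: "\<And>x' y' W'. W' \<subset> W \<Longrightarrow> piece2 x' y' W' \<Longrightarrow> \<exists>E'. solves2 x' y' W' E'"
  shows "\<exists>E'. admissible E' (\<Union>(side x v W)) {x, v} \<and>
    (\<forall>a\<in>insert v (\<Union>(side x v W)). linked E' UNIV a x) \<and>
    edge_deg E' x \<le> 1 + wsum x (insert v (\<Union>(side x v W))) \<and>
    edge_deg E' v \<le> 1 + wsum v (insert x (\<Union>(side x v W)))"
proof (rule two_terminal)
  have sub: "W \<subseteq> V - {x, y}" using piece2_subset[OF p] .
  show xv: "x \<noteq> v" "x \<in> V" "v \<in> V" using p v sub by (auto simp: piece2_def)
  have con: "connected_in E W" using p parts_connected by (auto simp: piece2_def)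
  have xy: "x \<noteq> y" "y \<in> V" "linked E (V - W) x y" using p by (auto simp: piece2_def)
  have Z: "Z \<in> parts E (V - {x, v})" "touches E Z {x}" "touches E Z {v}" "Z \<subseteq> W - {v}"
    "Z \<inter> \<Union>(side y v W) = {}"
    if Zs: "Z \<in> side x v W" for Z
  proof -
    have Zp: "Z \<in> parts E (W - {v})" and "touches E Z {x}" using Zs by (auto simp: side_def)
    then show "touches E Z {x}" "touches E Z {v}" "Z \<subseteq> W - {v}"
      using part_touches[OF con v] parts_subset by blast+
    show "Z \<inter> \<Union>(side y v W) = {}" using side_disjoint[OF sep] Zs by blast
    \<comment> \<open>Since \<open>v\<close> separates, \<open>Z\<close> stays away from
      \<open>y\<close>: its neighbours lie in \<open>W\<close> or equal \<open>x\<close>, and it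
      remains a component in the whole graph without \<open>x\<close> and \<open>v\<close>.\<close>
    have n: "\<not> touches E Z {y}" using sep Zp \<open>touches E Z {x}\<close> by blast
    show "Z \<in> parts E (V - {x, v})"
    proof (rule connected_partsI)
      show "connected_in E Z" using parts_connected[OF Zp] .
      show "Z \<subseteq> V - {x, v}" using \<open>Z \<subseteq> W - {v}\<close> sub by auto
      fix c d assume cd: "c \<in> Z" "d \<in> V - {x, v}" "{c, d} \<in> E"
      then have "d \<noteq> y" using n by (auto simp: touches_def)
      then have "d \<in> W - {v}" using piece2_nbr[OF p, of c d] cd \<open>Z \<subseteq> W - {v}\<close> by auto
      then show "d \<in> Z" using parts_closed[OF Zp] cd by blast
    qed
  qed
  show "side x v W \<subseteq> common_parts E V x v" using Z by (auto simp: common_parts_def)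
  \<comment> \<open>The additional bridge: \<open>y\<close> reaches \<open>v\<close> through its own
    side of \<open>W\<close>, and \<open>x\<close> by a walk outside \<open>W\<close>.\<close>
  let ?K = "part E (V - {x, v}) y"
  have "y \<notin> W" using sub by auto
  then have y: "y \<in> V - {x, v}" using xy v by auto
  have vy: "linked E (insert v (insert y (\<Union>(side y v W)))) y v"
    using linked_sym[OF side_linked[OF piece2_sym[OF p] v]] .
  have "touches E ?K {v}"
  proof -
    obtain z where z: "linked E (insert v (insert y (\<Union>(side y v W))) - {v}) y z" "{z, v} \<in> E"
      using linked_first_hit[OF vy] y by blast
    have "linked E (V - {x, v}) y z" using z(1)
      by (rule linked_mono) (use side_subset[of y v W] sub xy in auto)
    then show ?thesis using z(2) by (auto simp: touches_def part_def)
  qed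
  moreover have "touches E ?K {x}"
  proof -
    obtain z where z: "linked E (V - W - {x}) y z" "{z, x} \<in> E"
      using linked_first_hit[OF linked_sym[OF xy(3)]] xy(1) by blast
    have "linked E (V - {x, v}) y z" using z(1) by (rule linked_mono) (use v in auto)
    then show ?thesis using z(2) by (auto simp: touches_def part_def)
  qed
  ultimately show "?K \<in> common_parts E V x v" using y by (auto simp: common_parts_def parts_def)
  show "?K \<notin> side x v W"
    using part_self[OF y, of E] \<open>y \<notin> W\<close> side_subset[of x v W] by blast
  show "\<exists>E'. solves2 x v Z E'" if Zs: "Z \<in> side x v W" for Z
  proof (rule IH)
    note Z = Z[OF Zs]
    show "Z \<subset> W" using Z(4) v by auto
    \<comment> \<open>The new terminals \<open>x\<close> and \<open>v\<close> are linked outside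
      \<open>Z\<close> by way of \<open>y\<close>: around \<open>W\<close> to \<open>y\<close>, and
      from there through the components next to \<open>y\<close>.\<close>
    have "linked E (V - Z) x y" using xy(3) by (rule linked_mono) (use Z(4) in auto)
    moreover have "linked E (V - Z) y v" using vy
      by (rule linked_mono) (use Z(4,5) side_subset[of y v W] sub xy xv \<open>y \<notin> W\<close> in auto)
    ultimately have "linked E (V - Z) x v" using linked_trans by metis
    \<comment> \<open>From \<open>Z\<close> one reaches \<open>x\<close> and from there the root,
      all without \<open>v\<close>; a chosen pair \<open>(v, t)\<close> would have \<open>v\<close>
      separating \<open>t\<close> from the root.\<close>
    moreover have "(v, t) \<notin> C" if "t \<in> Z" for t
    proof
      assume "(v, t) \<in> C"
      then have n: "\<not> linked E (V - {v}) t \<rho>" using chosen by blast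
      have "connected_in E (Z \<union> {x})"
        using connected_Un_edge[OF parts_connected[OF Z(1)] connected_singleton Z(2)] .
      then have "linked E (Z \<union> {x}) t x" by (rule connected_in_linked) (use that in auto)
      then have "linked E (V - {v}) t x" by (rule linked_mono) (use Z(4) sub xv in auto)
      then show False using n linked_trans[OF piece2_root[OF p v]] by blast
    qed
    ultimately show "piece2 x v Z"
      using p Z xv unfolding piece2_def by blast
  qed
  \<comment> \<open>With no component next to \<open>x\<close>, its only neighbour in
    \<open>W\<close> is \<open>v\<close>. The edge is allowed because neither order of its ends is a
    chosen pair.\<close>
  show "{x, v} \<in> E - forbidden" if empty: "side x v W = {}"
  proof -
    obtain b where b: "b \<in> W" "{b, x} \<in> E" using p by (auto simp: piece2_def touches_def)
    have "b = v"
    proof (rule ccontr)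
      assume "b \<noteq> v"
      then obtain D where "D \<in> parts E (W - {v})" "b \<in> D" using b parts_cover[of b "W - {v}" E] by auto
      then show False using empty b unfolding side_def touches_def by blast
    qed
    moreover have "{x, v} \<notin> forbidden"
    proof
      assume "{x, v} \<in> forbidden"
      then have "(x, v) \<in> C \<or> (v, x) \<in> C" by (auto simp: forbidden_def doubleton_eq_iff)
      then show False
      proof
        assume "(x, v) \<in> C" then show False using p v by (auto simp: piece2_def)
      next
        assume "(v, x) \<in> C" then show False using chosen piece2_root[OF p v] by blast
      qed
    qed
    ultimately show ?thesis using b by (simp add: insert_commute)
  qed
qed

text \<open>If \<open>v\<close> were an \<open>s_i\<close>, its \<open>u = r_i\<close> would
  separate it from the root. As \<open>v\<close> reaches the root by way of \<open>x\<close> and by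
  way of \<open>y\<close>, \<open>u\<close> would lie on both sides of \<open>v\<close>, which are
  disjoint. The degree account at a splitting vertex has no room for the extra 1.\<close>

lemma piece2_not_chosen:
  assumes p: "piece2 x y W" and v: "v \<in> W"
    and sep: "\<forall>D\<in>parts E (W - {v}). \<not> (touches E D {x} \<and> touches E D {y})"
  shows "v \<notin> snd ` C"
proof
  assume "v \<in> snd ` C"
  then obtain u where u: "(u, v) \<in> C" by auto
  have "{v, u} \<in> E" using chosen[OF u] by (simp add: insert_commute)
  have sub: "W \<subseteq> V - {x, y}" using piece2_subset[OF p] .
  have uW: "u \<in> W - {v}" 
    using piece2_nbr[OF p v \<open>{v, u} \<in> E\<close>] p u v edge_ends[OF \<open>{v, u} \<in> E\<close>] by (auto simp: piece2_def)
  have no: "u \<in> \<Union>(side z v W)" if p': "piece2 z z' W" for z z'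
  proof (rule ccontr)
    assume "u \<notin> \<Union>(side z v W)"
    moreover have "z \<in> V" "u \<noteq> z" using p' uW piece2_subset[OF p'] by (auto simp: piece2_def)
    ultimately have "linked E (V - {u}) v z"
      using linked_mono[OF side_linked[OF p' v] order_refl, of "V - {u}"] side_subset[of z v W] uW v sub by auto
    then have "linked E (V - {u}) v \<rho>" using linked_trans[OF piece2_root[OF p', of u]] uW by blast
    then show False using chosen u by blast
  qed
  show False using no[OF p] no[OF piece2_sym[OF p]] side_disjoint[OF sep] by blast
qed

lemma piece2_separator:
  assumes p: "piece2 x y W"
  shows "\<exists>v\<in>W. \<forall>D\<in>parts E (W - {v}). \<not> (touches E D {x} \<and> touches E D {y})"
proof -
  have sub: "W \<subseteq> V - {x, y}" using piece2_subset[OF p] .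
  have p': "x \<noteq> y" "x \<in> V" "y \<in> V" "connected_in E W" "linked E (V - W) x y"
    "touches E W {x}" "touches E W {y}"
    using p parts_connected by (auto simp: piece2_def)
  \<comment> \<open>The terminals need not be adjacent; \<open>{x}\<close> is enlarged to its
    component outside \<open>W\<close> and \<open>y\<close> so that it touches
    \<open>{y}\<close>.\<close>
  define X where "X = part E (V - W - {y}) x"
  have x: "x \<in> V - W - {y}" using p' sub by auto
  have Xs: "X \<subseteq> V - W - {y}" "x \<in> X" unfolding X_def by (rule part_subset, rule part_self[OF x])
  obtain z where z: "linked E (V - W - {y}) x z" "{z, y} \<in> E"
    using linked_first_hit[OF p'(5,1)] by blast
  have "\<exists>v\<in>W. \<forall>D\<in>parts E (W - {v}). \<not> (touches E D X \<and> touches E D {y})"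
  proof (rule separating_vertex[where V = V])
    show "finite W" using sub finite_V finite_subset[of W V] by auto
    show "connected_in E X" unfolding X_def using connected_part x .
    show "touches E X {y}" using z by (auto simp: X_def part_def touches_def)
    show "touches E W X" using p'(6) touches_mono[of E W "{x}" W X] Xs by auto
  qed (use p' Xs sub connected_singleton no_K4 in auto)
  then show ?thesis using Xs(2) by (meson empty_subsetI insert_subset order_refl touches_mono)
qed

lemma piece2_step:
  assumes p: "piece2 x y W"
    and IH2: "\<And>x' y' W'. W' \<subset> W \<Longrightarrow> piece2 x' y' W' \<Longrightarrow> \<exists>E'. solves2 x' y' W' E'"
    and IH1: "\<And>v Y. Y \<subset> W \<Longrightarrow> piece1 v Y \<Longrightarrow> \<exists>E'. solves1 v Y E'"
  shows "\<exists>E'. solves2 x y W E'"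
proof -
  obtain v where v: "v \<in> W"
    and sep: "\<forall>D\<in>parts E (W - {v}). \<not> (touches E D {x} \<and> touches E D {y})"
    using piece2_separator[OF p] by blast
  have sep': "\<forall>D\<in>parts E (W - {v}). \<not> (touches E D {y} \<and> touches E D {x})" using sep by blast
  have sub: "W \<subseteq> V - {x, y}" using piece2_subset[OF p] .
  have xy: "x \<noteq> y" "x \<in> V" "y \<in> V" using p by (auto simp: piece2_def)
  define Ix where "Ix = \<Union>(side x v W)"
  define Iy where "Iy = \<Union>(side y v W)"
  define \<D> where "\<D> = parts E (W - {v}) - side x v W - side y v W"
  have W: "Ix \<union> Iy \<union> \<Union>\<D> = W - {v}"
  proof -
    have "side x v W \<union> side y v W \<union> \<D> = parts E (W - {v})" by (auto simp: side_def \<D>_def)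
    then show ?thesis unfolding Ix_def Iy_def by (metis Union_Un_distrib Union_parts)
  qed
  have "side z v W \<subseteq> parts E (W - {v})" for z by (auto simp: side_def)
  then have disj: "Ix \<inter> Iy = {}" "Ix \<inter> \<Union>\<D> = {}" "Iy \<inter> \<Union>\<D> = {}"
    unfolding Ix_def Iy_def \<D>_def
    using side_disjoint[OF sep] parts_disjoint[of _ E "W - {v}"] by blast+
  have fin: "finite W" using sub finite_V finite_subset[of W V] by auto
  then have fin': "finite Ix" "finite Iy" "finite (\<Union>\<D>)" using W by (metis finite_Diff finite_Un)+
  \<comment> \<open>A component that touches neither terminal has no neighbour but \<open>v\<close>
    outside itself, so it hangs from \<open>v\<close>.\<close>
  have \<D>: "\<D> \<subseteq> parts E (V - {v})"
  proof
    fix D assume D: "D \<in> \<D>"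
    then have Dp: "D \<in> parts E (W - {v})" "\<not> touches E D {x}" "\<not> touches E D {y}"
      by (auto simp: \<D>_def side_def)
    show "D \<in> parts E (V - {v})"
    proof (rule connected_partsI)
      show "connected_in E D" using parts_connected[OF Dp(1)] .
      show "D \<subseteq> V - {v}" using parts_subset[OF Dp(1)] sub by auto
      fix c d assume cd: "c \<in> D" "d \<in> V - {v}" "{c, d} \<in> E"
      then have "d \<noteq> x" "d \<noteq> y" using Dp by (auto simp: touches_def)
      then have "d \<in> W - {v}" using piece2_nbr[OF p, of c d] cd parts_subset[OF Dp(1)] by auto
      then show "d \<in> D" using parts_closed[OF Dp(1)] cd by blast
    qed
  qed
  obtain Ex where Ex: "admissible Ex Ix {x, v}" "\<forall>a\<in>insert v Ix. linked Ex UNIV a x"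
    "edge_deg Ex x \<le> 1 + wsum x (insert v Ix)" "edge_deg Ex v \<le> 1 + wsum v (insert x Ix)"
    using piece2_side[OF p v sep IH2] unfolding Ix_def by blast
  obtain Ey where Ey: "admissible Ey Iy {y, v}" "\<forall>a\<in>insert v Iy. linked Ey UNIV a y"
    "edge_deg Ey y \<le> 1 + wsum y (insert v Iy)" "edge_deg Ey v \<le> 1 + wsum v (insert y Iy)"
    using piece2_side[OF piece2_sym[OF p] v sep' IH2] unfolding Iy_def by blast
  have fin\<D>: "finite \<D>" using finite_parts[of "W - {v}" E] fin by (simp add: \<D>_def)
  have "\<exists>E'. solves1 v D E'" if "D \<in> \<D>" for D
  proof (rule IH1)
    show "D \<subset> W" using W that v by blast
    show "piece1 v D" using W that \<D> v sub p by (auto simp: piece1_def piece2_def)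
  qed
  then obtain E0 where E0: "admissible E0 (\<Union>\<D>) {v}" "\<forall>a\<in>\<Union>\<D>. linked E0 UNIV a v"
    "edge_deg E0 v \<le> card \<D> + wsum v (\<Union>\<D>)"
    using hang_pieces1[OF fin\<D> \<D>] by blast
  define E' where "E' = Ex \<union> Ey \<union> E0"
  have sub3: "Ix \<inter> {v, x, y} = {}" "Iy \<inter> {v, x, y} = {}" "\<Union>\<D> \<inter> {v, x, y} = {}" using W sub by blast+
  have "admissible (Ex \<union> Ey) (Ix \<union> Iy) {v, x, y}"
    by (rule admissible_Un) (use admissible_mono[OF Ex(1)] admissible_mono[OF Ey(1)] disj sub3 in auto)
  then have "admissible E' (Ix \<union> Iy \<union> \<Union>\<D>) {v, x, y}"
    unfolding E'_def by (rule admissible_Un) (use admissible_mono[OF E0(1)] disj sub3 in auto)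
  then have adm: "admissible E' (W - {v}) (insert v {x, y})" using W by simp
  have s: "\<Union>Ex \<subseteq> Ix \<union> {x, v}" "\<Union>Ey \<subseteq> Iy \<union> {y, v}" "\<Union>E0 \<subseteq> \<Union>\<D> \<union> {v}"
    using Ex(1) Ey(1) E0(1) by (simp_all add: admissible_def)
  have n: "x \<notin> Iy \<union> {y, v}" "x \<notin> \<Union>\<D> \<union> {v}" "y \<notin> Ix \<union> {x, v}" "y \<notin> \<Union>\<D> \<union> {v}"
    using v sub sub3 xy by auto
  have ext: "x \<notin> \<Union>(Ey \<union> E0)" "y \<notin> \<Union>(Ex \<union> E0)"
    using contra_subsetD[OF s(2) n(1)] contra_subsetD[OF s(3) n(2)]
      contra_subsetD[OF s(1) n(3)] contra_subsetD[OF s(3) n(4)] by simp_all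
  have ins: "insert v Ix \<subseteq> W" "insert v Iy \<subseteq> W" using W v by auto
  have "edge_deg E' x = edge_deg Ex x" unfolding E'_def using edge_deg_Un_left[OF ext(1)] by (simp add: Un_assoc)
  then have dx: "edge_deg E' x \<le> 1 + wsum x W"
    using Ex(3) wsum_mono[OF fin ins(1), of x] by linarith
  have "E' = Ey \<union> (Ex \<union> E0)" by (auto simp: E'_def)
  then have "edge_deg E' y = edge_deg Ey y" using edge_deg_Un_left[OF ext(2)] by simp
  then have dy: "edge_deg E' y \<le> 1 + wsum y W"
    using Ey(3) wsum_mono[OF fin ins(2), of y] by linarith
  \<comment> \<open>The weights at \<open>v\<close> come from three disjoint sets: \<open>x\<close>
    with its side, \<open>y\<close> with its side, and the hanging pieces. Of the
    \<open>2 + card \<D>\<close> further edges, \<open>card \<D> + 1\<close> are matched with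
    components of \<open>G - v\<close>, that of \<open>x\<close> being none of \<open>\<D>\<close>,
    and the last with the constant 1 in \<open>bounded\<close>.\<close>
  have "bounded E' v"
  proof -
    have d: "edge_deg E' v \<le> edge_deg Ex v + edge_deg Ey v + edge_deg E0 v"
      unfolding E'_def using edge_deg_Un[of "Ex \<union> Ey" E0 v] edge_deg_Un[of Ex Ey v] by linarith
    have "wsum v (insert x Ix) + wsum v (insert y Iy) = wsum v (insert x Ix \<union> insert y Iy)"
      using fin' disj sub3 xy by (intro wsum_Un[symmetric]) auto
    moreover have "wsum v (insert x Ix \<union> insert y Iy) + wsum v (\<Union>\<D>) = wsum v (insert x Ix \<union> insert y Iy \<union> \<Union>\<D>)"
      using fin' disj sub3 by (intro wsum_Un[symmetric]) auto
    moreover have "wsum v (insert x Ix \<union> insert y Iy \<union> \<Union>\<D>) \<le> wsum v V"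
      using W sub xy by (intro wsum_mono finite_V) auto
    moreover have "card (insert (part E (V - {v}) x) \<D>) \<le> card (parts E (V - {v}))"
      using \<D> xy v sub by (intro card_mono finite_parts_V) (auto simp: parts_def)
    moreover have "part E (V - {v}) x \<notin> \<D>"
      using part_self[of x "V - {v}" E] xy v sub W sub3(3) by blast
    ultimately show ?thesis
      unfolding bounded_def using d Ex(4) Ey(4) E0(3) piece2_not_chosen[OF p v sep] fin\<D> by simp
  qed
  then have "admissible E' W {x, y}" using admissible_interior[OF adm] v by (simp add: insert_absorb)
  moreover have "linked E' UNIV a x" if "a \<in> insert y W" for a
  proof -
    have mono: "linked Ex UNIV b c \<Longrightarrow> linked E' UNIV b c" "linked Ey UNIV b c \<Longrightarrow> linked E' UNIV b c"
      "linked E0 UNIV b c \<Longrightarrow> linked E' UNIV b c" for b c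
      using linked_mono[of _ UNIV b c E' UNIV] by (auto simp: E'_def)
    have vx: "linked E' UNIV v x" using Ex(2) mono(1) by blast
    have yv: "linked E' UNIV y v" using linked_sym[OF mono(2)] Ey(2) by blast
    have "a \<in> Ix \<or> a \<in> insert y Iy \<or> a \<in> \<Union>\<D> \<or> a = v" using W that by blast
    then consider "linked E' UNIV a x" | "linked E' UNIV a y" | "linked E' UNIV a v"
      using Ex(2) Ey(2) E0(2) mono vx linked_refl[of y UNIV E'] by blast
    then show ?thesis using linked_trans[OF vx] linked_trans[OF yv, of a] by cases blast+
  qed
  ultimately show ?thesis using dx dy unfolding solves2_def by blast
qed

section \<open>Pieces hanging from one vertex\<close>

lemma piece1_nbr: "piece1 v Y \<Longrightarrow> a \<in> Y \<Longrightarrow> {a, b} \<in> E \<Longrightarrow> b \<in> Y \<or> b = v"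
  unfolding piece1_def using parts_closed[of Y E "V - {v}" a b] edge_ends[of a b] by blast

lemma piece1_root:
  assumes p: "piece1 v Y" and u: "u \<in> Y"
  shows "linked E (V - {u}) v \<rho>"
proof -
  have v: "v \<in> V" "v \<notin> Y" using p parts_subset by (fastforce simp: piece1_def)+
  have "\<rho> \<in> Y \<or> linked E (V - Y) v \<rho>"
  proof (rule linked_from_outside)
    show "linked E V v \<rho>" using connected_in_linked[OF connected] v root by simp
    fix b c assume "b \<in> Y" "c \<in> V - Y" "{b, c} \<in> E"
    then have "c = v" using piece1_nbr[OF p] by blast
    then show "linked E (V - Y) v c" using v by (simp add: linked_refl)
  qed (use v in simp)
  then have "linked E (V - Y) v \<rho>" using p by (simp add: piece1_def)
  then show ?thesis by (rule linked_mono) (use u in auto)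
qed

text \<open>Splitting at the chosen \<open>t\<close> pays off because \<open>c(G, vt)\<close> is at
  most 1: at most one component of \<open>Y - {t}\<close> touches \<open>v\<close>, so
  \<open>v\<close> needs a single edge and no weight of \<open>{v, t}\<close>. That component
  replaces the edge \<open>vt\<close>, which is taken only if there is none.\<close>

lemma piece1_step:
  assumes p: "piece1 v Y"
    and IH2: "\<And>x' y' W'. W' \<subset> Y \<Longrightarrow> piece2 x' y' W' \<Longrightarrow> \<exists>E'. solves2 x' y' W' E'"
    and IH1: "\<And>v' Y'. Y' \<subset> Y \<Longrightarrow> piece1 v' Y' \<Longrightarrow> \<exists>E'. solves1 v' Y' E'"
  shows "\<exists>E'. solves1 v Y E'"
proof -
  have p': "v \<in> V" "Y \<in> parts E (V - {v})" "\<rho> \<notin> Y" using p by (auto simp: piece1_def)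
  have con: "connected_in E Y" and sub: "Y \<subseteq> V - {v}" using p' parts_connected parts_subset by blast+
  obtain t where t: "t \<in> Y" "(v, t) \<in> C" and uniq: "\<And>t'. t' \<in> Y \<Longrightarrow> (v, t') \<in> C \<Longrightarrow> t' = t"
    using chosen_ex1[OF p'] by blast
  have vt: "{v, t} \<in> E" "card (common_parts E V v t) \<le> 1" "v \<noteq> t" "t \<in> V"
    using chosen[OF t(2)] t(1) sub by auto
  define \<D>1 where "\<D>1 = side v t Y"
  define \<D>0 where "\<D>0 = parts E (Y - {t}) - \<D>1"
  have D01: "\<D>1 \<union> \<D>0 = parts E (Y - {t})" by (auto simp: \<D>0_def \<D>1_def side_def)
  have Y: "\<Union>\<D>1 \<union> \<Union>\<D>0 = Y - {t}"
    using D01 Union_parts[of E "Y - {t}"] by (metis Union_Un_distrib)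
  have disj: "\<Union>\<D>1 \<inter> \<Union>\<D>0 = {}"
    using D01 parts_disjoint[of _ E "Y - {t}"] unfolding \<D>0_def by blast
  have fin: "finite Y" using p'(2) finite_part by blast
  have fin': "finite (\<Union>\<D>1)" "finite (\<Union>\<D>0)" using Y fin by (metis finite_Diff finite_Un)+
  have fin\<D>: "finite \<D>0" using finite_parts[of "Y - {t}" E] fin by (simp add: \<D>0_def)
  have D1: "D \<in> common_parts E V v t" if D: "D \<in> \<D>1" for D
  proof -
    have Dp: "D \<in> parts E (Y - {t})" "touches E D {v}" using D by (auto simp: \<D>1_def side_def)
    have "D \<in> parts E (V - {v, t})"
    proof (rule connected_partsI)
      show "connected_in E D" using parts_connected[OF Dp(1)] .
      show "D \<subseteq> V - {v, t}" using parts_subset[OF Dp(1)] sub by auto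
      fix c d assume cd: "c \<in> D" "d \<in> V - {v, t}" "{c, d} \<in> E"
      then have "d \<in> Y - {t}" using piece1_nbr[OF p, of c d] parts_subset[OF Dp(1)] by auto
      then show "d \<in> D" using parts_closed[OF Dp(1)] cd by blast
    qed
    then show ?thesis using Dp part_touches[OF con t(1) Dp(1)] by (simp add: common_parts_def)
  qed
  have D0: "D \<in> parts E (V - {t})" "\<not> touches E D {v}" if D: "D \<in> \<D>0" for D
  proof -
    have Dp: "D \<in> parts E (Y - {t})" "\<not> touches E D {v}" using D by (auto simp: \<D>0_def \<D>1_def side_def)
    then show "\<not> touches E D {v}" by simp
    show "D \<in> parts E (V - {t})"
    proof (rule connected_partsI)
      show "connected_in E D" using parts_connected[OF Dp(1)] .
      show "D \<subseteq> V - {t}" using parts_subset[OF Dp(1)] sub by auto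
      fix c d assume cd: "c \<in> D" "d \<in> V - {t}" "{c, d} \<in> E"
      then have "d \<noteq> v" using Dp(2) by (auto simp: touches_def)
      then have "d \<in> Y - {t}" using piece1_nbr[OF p, of c d] parts_subset[OF Dp(1)] cd by auto
      then show "d \<in> D" using parts_closed[OF Dp(1)] cd by blast
    qed
  qed
  have "\<exists>E1. admissible E1 (\<Union>\<D>1) {v, t} \<and> (\<forall>a\<in>insert t (\<Union>\<D>1). linked E1 UNIV a v) \<and>
    edge_deg E1 v \<le> 1 + wsum v (\<Union>\<D>1) \<and> edge_deg E1 t \<le> 1 + wsum t (\<Union>\<D>1)"
  proof (cases "\<D>1 = {}")
    case True
    \<comment> \<open>A common component would enter \<open>Y\<close> next to \<open>t\<close> and
      so lie inside a member of \<open>\<D>0\<close>, none of which touches \<open>v\<close>. Hence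
      the count is 0 and the edge \<open>vt\<close> is allowed.\<close>
    have none: "common_parts E V v t = {}"
    proof (rule ccontr)
      assume "common_parts E V v t \<noteq> {}"
      then obtain K where K: "K \<in> parts E (V - {v, t})" "touches E K {v}" "touches E K {t}"
        by (auto simp: common_parts_def)
      then obtain a where a: "a \<in> K" "{t, a} \<in> E" by (auto simp: touches_def insert_commute)
      then have "a \<in> Y - {t}" using piece1_nbr[OF p t(1) a(2)] parts_subset[OF K(1)] by auto
      then obtain D where D: "D \<in> \<D>0" "a \<in> D" using Y True by auto
      have "K \<subseteq> D"
      proof
        fix b assume "b \<in> K"
        then have "linked E K a b" using connected_in_linked[OF parts_connected[OF K(1)]] a by simp
        then have "linked E (V - {t}) a b" by (rule linked_mono) (use parts_subset[OF K(1)] in auto)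
        then show "b \<in> D" using parts_linked D0(1) D by metis
      qed
      then show False using K(2) D0(2)[OF D(1)] touches_mono[of E K "{v}" D "{v}"] by blast
    qed
    have "{v, t} \<notin> forbidden"
      using none common_parts_commute[of E V v t] by (auto simp: forbidden_def doubleton_eq_iff)
    moreover have "edge_deg {{v, t}} b \<le> 1" for b by (simp add: edge_deg_def card_le_Suc0_iff_eq)
    moreover have "linked {{v, t}} UNIV t v" by (rule linked_edge) auto
    ultimately show ?thesis
      using True vt(1) by (intro exI[of _ "{{v, t}}"]) (auto simp: admissible_def intro: le_trans)
  next
    case False
    then obtain Z where Z: "Z \<in> \<D>1" by blast
    have "finite (common_parts E V v t)" using finite_parts_V by (simp add: common_parts_def)
    then have "Z' = Z" if "Z' \<in> \<D>1" for Z'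
      using D1[OF that] D1[OF Z] vt(2) by (simp add: card_le_Suc0_iff_eq)
    then have \<D>1: "\<D>1 = {Z}" using Z by blast
    have ZY: "Z \<subseteq> Y - {t}" using Y \<D>1 by blast
    have Zp: "Z \<in> parts E (V - {v, t})" "touches E Z {v}" "touches E Z {t}"
      using D1[OF Z] by (auto simp: common_parts_def)
    have "\<exists>E'. solves2 v t Z E'"
    proof (rule IH2)
      show "Z \<subset> Y" using ZY t(1) by auto
      \<comment> \<open>The edge \<open>vt\<close> is the required link outside \<open>Z\<close>,
        although as a forbidden edge it stays out of the solution. The uniqueness of
        \<open>t\<close> in \<open>Y\<close> excludes chosen pairs from \<open>v\<close> into
        \<open>Z\<close>.\<close>
      have "linked E (V - Z) v t" by (rule linked_edge[OF vt(1)]) (use ZY p'(1) t(1) sub in auto)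
      moreover have "(v, t') \<notin> C" if "t' \<in> Z" for t' using uniq[of t'] that ZY by blast
      moreover have "(t, t') \<notin> C" if "t' \<in> Z" for t'
      proof
        assume "(t, t') \<in> C"
        then have n: "\<not> linked E (V - {t}) t' \<rho>" using chosen by blast
        have "connected_in E (Z \<union> {v})"
          using connected_Un_edge[OF parts_connected[OF Zp(1)] connected_singleton Zp(2)] .
        then have "linked E (Z \<union> {v}) t' v" by (rule connected_in_linked) (use that in auto)
        then have "linked E (V - {t}) t' v" by (rule linked_mono) (use ZY sub vt p' in auto)
        then show False using n linked_trans[OF piece1_root[OF p t(1)]] by blast
      qed
      ultimately show "piece2 v t Z"
        using Zp vt(3,4) p' ZY unfolding piece2_def by blast
    qed
    then show ?thesis using \<D>1 unfolding solves2_def by auto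
  qed
  then obtain E1 where E1: "admissible E1 (\<Union>\<D>1) {v, t}" "\<forall>a\<in>insert t (\<Union>\<D>1). linked E1 UNIV a v"
    "edge_deg E1 v \<le> 1 + wsum v (\<Union>\<D>1)" "edge_deg E1 t \<le> 1 + wsum t (\<Union>\<D>1)" by blast
  have "\<exists>E'. solves1 t D E'" if "D \<in> \<D>0" for D
  proof (rule IH1)
    show "D \<subset> Y" using Y that t(1) by blast
    show "piece1 t D" using Y that D0(1)[OF that] vt(4) p'(3) by (auto simp: piece1_def)
  qed
  then obtain E0 where E0: "admissible E0 (\<Union>\<D>0) {t}" "\<forall>a\<in>\<Union>\<D>0. linked E0 UNIV a t"
    "edge_deg E0 t \<le> card \<D>0 + wsum t (\<Union>\<D>0)"
    using hang_pieces1[OF fin\<D>, of t] D0(1) by blast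
  define E' where "E' = E1 \<union> E0"
  have out: "\<Union>\<D>1 \<inter> {t, v} = {}" "\<Union>\<D>0 \<inter> {t, v} = {}" using Y sub by blast+
  have "admissible E' (\<Union>\<D>1 \<union> \<Union>\<D>0) {t, v}"
    unfolding E'_def by (rule admissible_Un) (use admissible_mono[OF E1(1)] admissible_mono[OF E0(1)] disj out in auto)
  then have adm: "admissible E' (Y - {t}) (insert t {v})" using Y by simp
  have s: "\<Union>E0 \<subseteq> \<Union>\<D>0 \<union> {t}" using E0(1) by (simp add: admissible_def)
  have n: "v \<notin> \<Union>\<D>0 \<union> {t}" using out vt(3) by auto
  have "edge_deg E' v = edge_deg E1 v"
    unfolding E'_def using contra_subsetD[OF s n] by (rule edge_deg_Un_left)
  moreover have "wsum v (\<Union>\<D>1) \<le> wsum v Y" using Y by (intro wsum_mono fin) blast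
  ultimately have dv: "edge_deg E' v \<le> 1 + wsum v Y" using E1(3) by linarith
  \<comment> \<open>Apart from its hanging pieces, \<open>t\<close> pays for one direction only,
    where a splitting vertex pays for two. The difference is the extra 1 required of
    \<open>t\<close> as an \<open>s_i\<close>.\<close>
  have "bounded E' t"
  proof -
    have "edge_deg E' t \<le> edge_deg E1 t + edge_deg E0 t" unfolding E'_def by (rule edge_deg_Un)
    moreover have "wsum t (\<Union>\<D>1) + wsum t (\<Union>\<D>0) = wsum t (Y - {t})"
      using wsum_Un[OF fin' disj] Y by simp
    moreover have "wsum t (Y - {t}) \<le> wsum t V" using sub by (intro wsum_mono finite_V) auto
    moreover have "card (insert (part E (V - {t}) v) \<D>0) \<le> card (parts E (V - {t}))"
      using D0(1) p'(1) vt(3) by (intro card_mono finite_parts_V) (auto simp: parts_def)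
    moreover have "part E (V - {t}) v \<notin> \<D>0"
      using part_self[of v "V - {t}" E] p'(1) vt(3) out(2) by blast
    ultimately show ?thesis
      unfolding bounded_def using E1(4) E0(3) fin\<D> by simp
  qed
  then have "admissible E' Y {v}" using admissible_interior[OF adm] t(1) by (simp add: insert_absorb)
  moreover have "linked E' UNIV a v" if "a \<in> Y" for a
  proof -
    have mono: "linked E1 UNIV b c \<Longrightarrow> linked E' UNIV b c" "linked E0 UNIV b c \<Longrightarrow> linked E' UNIV b c" for b c
      using linked_mono[of _ UNIV b c E' UNIV] by (auto simp: E'_def)
    have tv: "linked E' UNIV t v" using E1(2) mono(1) by blast
    have "a \<in> insert t (\<Union>\<D>1) \<or> a \<in> \<Union>\<D>0" using Y that by blast
    then show ?thesis using E1(2) E0(2) mono linked_trans[OF tv, of a] by blast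
  qed
  ultimately show ?thesis using dv unfolding solves1_def by blast
qed

text \<open>The induction is simultaneous because each kind of piece produces pieces of both kinds,
  always on proper subsets.\<close>

lemma pieces_solvable:
  "(\<forall>x y. piece2 x y A \<longrightarrow> (\<exists>E'. solves2 x y A E')) \<and> (\<forall>v. piece1 v A \<longrightarrow> (\<exists>E'. solves1 v A E'))"
proof (induction "card A" arbitrary: A rule: less_induct)
  case less
  have IH: "(\<forall>x y. piece2 x y A' \<longrightarrow> (\<exists>E'. solves2 x y A' E')) \<and> (\<forall>v. piece1 v A' \<longrightarrow> (\<exists>E'. solves1 v A' E'))"
    if "A' \<subset> A" "finite A" for A'
    using less.hyps[of A'] psubset_card_mono that by blast
  have fin: "finite A" if "piece2 x y A \<or> piece1 x A" for x y
    using that finite_part unfolding piece1_def piece2_def by blast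
  show ?case
    using piece2_step[of _ _ A] piece1_step[of _ A] IH fin by meson
qed

text \<open>At the root everything hangs, at one edge per component of \<open>G - \<rho>\<close>.
  This is one less than \<open>bounded\<close> permits, the saving required at
  \<open>r_0\<close>.\<close>

theorem bounded_spanning_set:
  "\<exists>E'\<subseteq>E - forbidden. (\<forall>a\<in>V. linked E' V a \<rho>) \<and> (\<forall>a\<in>V. bounded E' a) \<and>
     edge_deg E' \<rho> \<le> wsum \<rho> V + card (parts E (V - {\<rho>}))"
proof -
  let ?P = "parts E (V - {\<rho>})"
  have "\<exists>E'. solves1 \<rho> Y E'" if "Y \<in> ?P" for Y
  proof -
    have "piece1 \<rho> Y" using that root parts_subset[OF that] by (auto simp: piece1_def)
    then show ?thesis using pieces_solvable by blast
  qed
  then obtain E' where E': "admissible E' (\<Union>?P) {\<rho>}" "\<forall>a\<in>\<Union>?P. linked E' UNIV a \<rho>"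
    "edge_deg E' \<rho> \<le> card ?P + wsum \<rho> (\<Union>?P)"
    using hang_pieces1[OF finite_parts_V order_refl, of \<rho>] by blast
  have "wsum \<rho> (\<Union>?P) \<le> wsum \<rho> V" by (rule wsum_mono[OF finite_V]) (auto simp: Union_parts)
  then have deg: "edge_deg E' \<rho> \<le> wsum \<rho> V + card ?P" using E'(3) by linarith
  \<comment> \<open>The second vertex of a chosen pair is separated from the root, and the root is
    not separated from itself.\<close>
  have "\<rho> \<notin> snd ` C"
  proof
    assume "\<rho> \<in> snd ` C"
    then obtain u where u: "(u, \<rho>) \<in> C" by auto
    then have "{u, \<rho>} \<in> E" "\<not> linked E (V - {u}) \<rho> \<rho>" using chosen by blast+
    then show False using edge_ends[of u \<rho>] by (auto intro: linked_refl)
  qed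
  then have "bounded E' \<rho>" unfolding bounded_def using deg by simp
  moreover have V: "V = insert \<rho> (\<Union>?P)" using Union_parts[of E "V - {\<rho>}"] root by auto
  ultimately have "\<forall>a\<in>V. bounded E' a"
    using E'(1) unfolding admissible_def by (metis insert_iff)
  moreover have "linked E' V a \<rho>" if "a \<in> V" for a
  proof -
    have "linked E' UNIV a \<rho>" using that V E'(2) by (metis UNIV_I insert_iff linked_refl)
    then have "linked E' (UNIV \<inter> V) a \<rho>"
    proof (rule linked_closed)
      show "a \<in> V" using that .
      fix c d assume "{c, d} \<in> E'"
      then have "{c, d} \<in> E" using E'(1) unfolding admissible_def by blast
      then show "d \<in> V" using edge_ends by blast
    qed
    then show ?thesis by simp
  qed
  ultimately show ?thesis using E'(1) deg unfolding admissible_def by blast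
qed

end

section \<open>Components, bridges and spanning trees of graphs\<close>

lemma linked_cong:
  assumes "\<And>b c. b \<in> A \<Longrightarrow> c \<in> A \<Longrightarrow> {b, c} \<in> E \<longleftrightarrow> {b, c} \<in> E'"
  shows "linked E A a b \<longleftrightarrow> linked E' A a b"
proof -
  have *: "linked F' A a b" if "linked F A a b" "\<And>b c. b \<in> A \<Longrightarrow> c \<in> A \<Longrightarrow> {b, c} \<in> F \<Longrightarrow> {b, c} \<in> F'" for F F'
    using linked_map[OF that(1), of id F'] that(2) by simp
  show ?thesis using *[of E E'] *[of E' E] assms by blast
qed

lemma parts_cong:
  assumes "\<And>b c. b \<in> A \<Longrightarrow> c \<in> A \<Longrightarrow> {b, c} \<in> E \<longleftrightarrow> {b, c} \<in> E'"
  shows "parts E A = parts E' A"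
  using linked_cong[OF assms, of A] by (simp add: parts_def part_def)

lemma linked_successively:
  assumes "successively (adjacent G) (a # p)" "set (a # p) \<subseteq> A" "b \<in> set (a # p)"
  shows "linked (eset G) A a b"
  using assms
proof (induction p arbitrary: a)
  case (Cons c p)
  then have "linked (eset G) A a c" by (auto simp: adjacent_def intro: linked_edge)
  moreover have "linked (eset G) A c b" if "b \<noteq> a" using Cons that by auto
  moreover have "linked (eset G) A a a" using Cons.prems by (auto intro: linked_refl)
  ultimately show ?case using linked_trans by metis
qed (auto intro: linked_refl)

lemma graph_path_snoc:
  "graph_path G p \<Longrightarrow> adjacent G (last p) c \<Longrightarrow> c \<in> vset G \<Longrightarrow> c \<notin> set p \<Longrightarrow> graph_path G (p @ [c])"
  unfolding graph_path_def by (auto simp: successively_append_iff)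

lemma path_iff_linked:
  "(\<exists>p. graph_path G p \<and> hd p = a \<and> last p = b) \<longleftrightarrow> linked (eset G) (vset G) a b"
proof
  assume "\<exists>p. graph_path G p \<and> hd p = a \<and> last p = b"
  then obtain p where p: "graph_path G p" "hd p = a" "last p = b" by blast
  then obtain q where "p = a # q" by (cases p) (auto simp: graph_path_def)
  then show "linked (eset G) (vset G) a b"
    using p linked_successively[of G a q "vset G" b] last_in_set[of p] by (auto simp: graph_path_def)
next
  show "linked (eset G) (vset G) a b \<Longrightarrow> \<exists>p. graph_path G p \<and> hd p = a \<and> last p = b"
  proof (induction rule: linked.induct)
    case (linked_refl a)
    then show ?case by (intro exI[of _ "[a]"]) (auto simp: graph_path_def)
  next
    case (linked_step a b c)
    then obtain p where p: "graph_path G p" "hd p = a" "last p = b" by blast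
    show ?case
    \<comment> \<open>If the walk returns to a vertex of the path built so far, the path is cut off
      there.\<close>
    proof (cases "c \<in> set p")
      case True
      then obtain p1 p2 where "p = p1 @ c # p2" by (meson split_list)
      then have "graph_path G (p1 @ [c])" "hd (p1 @ [c]) = a"
        using p by (auto simp: graph_path_def successively_append_iff hd_append)
      then show ?thesis by (intro exI[of _ "p1 @ [c]"]) auto
    next
      case False
      then have "graph_path G (p @ [c])"
        using graph_path_snoc p linked_step by (metis adjacent_def)
      moreover have "hd (p @ [c]) = a" using p by (auto simp: graph_path_def)
      ultimately show ?thesis by (intro exI[of _ "p @ [c]"]) auto
    qed
  qed
qed

lemma graph_connected_iff: "graph_connected G \<longleftrightarrow> connected_in (eset G) (vset G)"
  unfolding graph_connected_def connected_in_def path_iff_linked ..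

definition induced :: "'a graph \<Rightarrow> 'a set \<Rightarrow> 'a graph" where
  "induced G A = (A, {e \<in> eset G. e \<subseteq> A})"

lemma linked_induced: "linked {e \<in> E. e \<subseteq> A} A a b \<longleftrightarrow> linked E A a b"
  by (rule linked_cong) auto

lemma connected_induced: "connected_in {e \<in> E. e \<subseteq> A} A \<longleftrightarrow> connected_in E A"
  by (simp add: connected_in_def linked_induced)

lemma is_subgraph_induced: "A \<subseteq> vset G \<Longrightarrow> is_subgraph (induced G A) G"
  by (auto simp: is_subgraph_def induced_def)

text \<open>Adding edges between its own vertices keeps a subgraph connected, so by maximality a
  component is induced and is determined by its vertex set.\<close>

lemma graph_components_eq:
  assumes "\<forall>e\<in>eset G. e \<subseteq> vset G"
  shows "graph_components G = induced G ` parts (eset G) (vset G)"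
proof (intro equalityI subsetI)
  fix H assume "H \<in> graph_components G"
  then have H: "is_subgraph H G" "connected_in (eset H) (vset H)"
    and max: "\<And>H'. is_subgraph H' G \<Longrightarrow> connected_in (eset H') (vset H') \<Longrightarrow> is_subgraph H H' \<Longrightarrow> H' = H"
    by (auto simp: graph_components_def maximal_subgraphs_def graph_connected_iff)
  obtain a where a: "a \<in> vset H" using H(2) by (auto simp: connected_in_def)
  have sub: "vset H \<subseteq> vset G" "eset H \<subseteq> eset G" using H(1) by (auto simp: is_subgraph_def)
  let ?K = "part (eset G) (vset G) a"
  have aG: "a \<in> vset G" using a sub by blast
  have "vset H \<subseteq> ?K"
    using linked_mono[OF connected_in_linked[OF H(2) a] sub(2,1)] by (auto simp: part_def)
  then have "is_subgraph H (induced G ?K)"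
    using H(1) unfolding is_subgraph_def induced_def by fastforce
  moreover have "is_subgraph (induced G ?K) G" by (rule is_subgraph_induced[OF part_subset])
  moreover have "connected_in (eset (induced G ?K)) (vset (induced G ?K))"
    using connected_part[OF aG] by (simp add: induced_def connected_induced)
  ultimately have "induced G ?K = H" using max by blast
  then show "H \<in> induced G ` parts (eset G) (vset G)" using aG by (auto simp: parts_def)
next
  fix H assume "H \<in> induced G ` parts (eset G) (vset G)"
  then obtain K where K: "K \<in> parts (eset G) (vset G)" "H = induced G K" by blast
  have con: "connected_in (eset G) K" and sub: "K \<subseteq> vset G"
    using parts_connected[OF K(1)] parts_subset[OF K(1)] .
  obtain a where a: "a \<in> K" using con by (auto simp: connected_in_def)
  have "H' = H" if H': "is_subgraph H' G" "connected_in (eset H') (vset H')" "is_subgraph H H'" for H'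
  proof -
    have KH': "K \<subseteq> vset H'" "eset H \<subseteq> eset H'" using H'(3) K(2) by (auto simp: is_subgraph_def induced_def)
    have subH': "vset H' \<subseteq> vset G" "eset H' \<subseteq> eset G" "\<forall>e\<in>eset H'. e \<subseteq> vset H'"
      using H'(1) by (auto simp: is_subgraph_def)
    have "b \<in> K" if "b \<in> vset H'" for b
    proof -
      have "linked (eset H') (vset H') a b" using connected_in_linked[OF H'(2)] a KH' that by blast
      then have "linked (eset G) (vset G) a b" using linked_mono subH' by metis
      then show ?thesis using parts_linked[OF K(1) a] by blast
    qed
    then have "vset H' = K" using KH' by blast
    moreover have "eset H' = eset H"
      using KH' subH' calculation K(2) by (auto simp: induced_def)
    ultimately show ?thesis using K(2) by (simp add: prod_eq_iff induced_def)
  qed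
  moreover have "is_subgraph H G" using is_subgraph_induced[OF sub] K(2) by simp
  moreover have "connected_in (eset H) (vset H)" using con K(2) by (simp add: induced_def connected_induced)
  ultimately show "H \<in> graph_components G"
    by (auto simp: graph_components_def maximal_subgraphs_def graph_connected_iff)
qed

lemma inj_induced: "inj (induced G)"
  by (auto simp: inj_def induced_def)

lemma num_components_eq:
  "\<forall>e\<in>eset G. e \<subseteq> vset G \<Longrightarrow> num_components G = card (parts (eset G) (vset G))"
  unfolding num_components_def by (simp add: graph_components_eq card_image inj_induced inj_on_subset[OF inj_induced])

lemma parts_delete_vertices:
  "parts (eset (delete_vertices G S)) (vset (delete_vertices G S)) = parts (eset G) (vset G - S)"
  unfolding delete_vertices_def fst_conv snd_conv by (rule parts_cong) auto

lemma num_components_delete: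
  assumes "\<forall>e\<in>eset G. e \<subseteq> vset G"
  shows "num_components (delete_vertices G S) = card (parts (eset G) (vset G - S))"
proof -
  have "\<forall>e\<in>eset (delete_vertices G S). e \<subseteq> vset (delete_vertices G S)"
    using assms by (auto simp: delete_vertices_def)
  then show ?thesis by (simp only: num_components_eq parts_delete_vertices)
qed

text \<open>Bridges are counted as graphs. Dropping \<open>u\<close> and \<open>v\<close> from the
  vertices of a bridge recovers its component, so different components give different
  bridges.\<close>

lemma num_bridges_eq:
  assumes "\<forall>e\<in>eset G. e \<subseteq> vset G" 
  shows "num_bridges G {u, v} = card (common_parts (eset G) (vset G) u v)"
proof -
  let ?D = "delete_vertices G {u, v}"
  let ?P = "parts (eset G) (vset G - {u, v})"
  let ?b = "\<lambda>K. bridge_of G {u, v} (induced ?D K)"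
  have "\<forall>e\<in>eset ?D. e \<subseteq> vset ?D" using assms by (auto simp: delete_vertices_def)
  then have nb: "nontrivial_bridges G {u, v} = ?b ` ?P"
    unfolding nontrivial_bridges_def by (simp only: graph_components_eq parts_delete_vertices image_image)
  have vb: "vset (?b K) = K \<union> {s \<in> {u, v}. touches (eset G) K {s}}" for K
    by (auto simp: bridge_of_def induced_def touches_def)
  have K: "K \<inter> {u, v} = {}" if "K \<in> ?P" for K using parts_subset[OF that] by blast
  have inj: "inj_on ?b ?P"
  proof (rule inj_onI)
    fix K K' assume "K \<in> ?P" "K' \<in> ?P" "?b K = ?b K'"
    then have "vset (?b K) - {u, v} = vset (?b K') - {u, v}" by simp
    then show "K = K'" using K[OF \<open>K \<in> ?P\<close>] K[OF \<open>K' \<in> ?P\<close>] unfolding vb by blast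
  qed
  have "{D \<in> nontrivial_bridges G {u, v}. {u, v} \<subseteq> vset D} = ?b ` common_parts (eset G) (vset G) u v"
  proof -
    have iff: "{u, v} \<subseteq> vset (?b K) \<longleftrightarrow> touches (eset G) K {u} \<and> touches (eset G) K {v}" if "K \<in> ?P" for K
      using K[OF that] unfolding vb by auto
    show ?thesis unfolding nb common_parts_def using iff by blast
  qed
  then show ?thesis
    unfolding num_bridges_def using inj
    by (metis (no_types, lifting) card_image common_parts_def inj_on_subset mem_Collect_eq subsetI)
qed

text \<open>Invariant of a walk from \<open>u\<close> that cannot use the edge \<open>ut\<close>:
  apart from returns to \<open>u\<close>, it stays in components of \<open>G - {u, t}\<close> that
  touch \<open>u\<close>, and none of these touches \<open>t\<close>.\<close>

lemma spanning_edge_needed: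
  assumes conn: "linked E' V u t" and sub: "E' \<subseteq> E" and "u \<noteq> t" and none: "common_parts E V u t = {}"
  shows "{u, t} \<in> E'"
proof (rule ccontr)
  assume n: "{u, t} \<notin> E'"
  have "b = u \<or> (b \<noteq> t \<and> b \<in> V \<and> touches E (part E (V - {u, t}) b) {u})" if "linked E' V u b" for b
    using that \<open>u \<noteq> t\<close> n none
  proof (induction rule: linked.induct)
    case (linked_step u b c)
    have bc: "{b, c} \<in> E" using linked_step sub by blast
    have IH: "b = u \<or> (b \<noteq> t \<and> b \<in> V \<and> touches E (part E (V - {u, t}) b) {u})"
      using linked_step by blast
    show ?case
    proof (cases "b = u")
      case True
      then have "c \<noteq> t" using linked_step by auto
      moreover have "touches E (part E (V - {u, t}) c) {u}" if "c \<noteq> u"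
        using bc True that \<open>c \<noteq> t\<close> linked_step part_self[of c "V - {u, t}" E]
        by (auto simp: touches_def insert_commute)
      ultimately show ?thesis using linked_step by blast
    next
      case False
      let ?K = "part E (V - {u, t}) b"
      have b: "b \<in> V - {u, t}" "touches E ?K {u}" using IH False by auto
      then have KP: "?K \<in> parts E (V - {u, t})" by (auto simp: parts_def)
      have "c \<noteq> t"
      proof
        assume "c = t"
        then have "touches E ?K {t}" using bc part_self[OF b(1), of E] by (auto simp: touches_def)
        then have "?K \<in> common_parts E V u t" using b KP by (simp add: common_parts_def)
        then show False using linked_step by blast
      qed
      moreover have "part E (V - {u, t}) c = ?K" if "c \<noteq> u"
        using part_eq[OF linked_edge[OF bc b(1)]] that \<open>c \<noteq> t\<close> linked_step by blast
      ultimately show ?thesis using b linked_step by metis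
    qed
  qed simp
  then show False using conn \<open>u \<noteq> t\<close> by blast
qed

section \<open>Spanning trees inside connected edge sets\<close>

lemma linked_remove_edge:
  assumes "linked (E - {{x, y}}) A x y" "linked E A a b"
  shows "linked (E - {{x, y}}) A a b"
  using assms(2,1)
proof (induction rule: linked.induct)
  case (linked_step a b c)
  have "linked (E - {{x, y}}) A b c"
  proof (cases "{b, c} = {x, y}")
    case True
    then show ?thesis using linked_step linked_sym by (fastforce simp: doubleton_eq_iff)
  next
    case False
    then show ?thesis using linked_step linked_in by (intro linked_edge) (fast+)
  qed
  then show ?case using linked_step linked_trans by metis
qed (auto intro: linked_refl)

text \<open>A connected edge set of least size is a tree, since an edge closing a cycle could be
  dropped.\<close>

lemma spanning_tree_in:
  assumes "finite E" "connected_in E V" "\<forall>e\<in>E. e \<subseteq> V"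
  shows "\<exists>E'\<subseteq>E. is_tree (V, E')"
proof -
  define P where "P E' \<longleftrightarrow> E' \<subseteq> E \<and> connected_in E' V" for E'
  have "P E" using assms by (simp add: P_def)
  then obtain E' where E': "P E'" "\<And>F. P F \<Longrightarrow> card E' \<le> card F"
    using ex_has_least_nat[of P E card] by blast
  have fin: "finite E'" using E'(1) assms(1) finite_subset by (auto simp: P_def)
  have "\<not> graph_cycle (V, E') p" for p
  proof
    assume c: "graph_cycle (V, E') p"
    then have p: "distinct p" "set p \<subseteq> V" "successively (adjacent (V, E')) p" "length p \<ge> 3"
      "{last p, hd p} \<in> E'" by (auto simp: graph_cycle_def graph_path_def adjacent_def)
    then obtain a q b where q: "p = a # q @ [b]" "q \<noteq> []"
      by (cases p; cases "tl p" rule: rev_cases) (auto simp: Suc_le_eq)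
    \<comment> \<open>The cycle has at least three vertices, so \<open>q\<close> is nonempty and the
      path from \<open>a\<close> through \<open>q\<close> to \<open>b\<close> avoids the closing
      edge \<open>{b, a}\<close>.\<close>
    let ?F = "E' - {{b, a}}"
    have "successively (adjacent (V, E')) (a # q)" "adjacent (V, E') (last q) b"
      using p(3) q by (auto simp: successively_append_iff successively_Cons)
    then have "linked E' (V - {b}) a (last q)"
      using linked_successively[of "(V, E')" a q "V - {b}" "last q"] p(1,2) q by auto
    then have "linked ?F V a (last q)" by (rule linked_Diff_edge) simp
    moreover have "{last q, b} \<in> ?F"
      using \<open>adjacent (V, E') (last q) b\<close> p(1) q last_in_set[OF q(2)]
      by (auto simp: adjacent_def doubleton_eq_iff)
    moreover have "b \<in> V" using p(2) q by simp
    ultimately have "linked ?F V a b" by (rule linked_step)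
    then have "linked ?F V b a" by (rule linked_sym)
    then have "connected_in ?F V"
      using E'(1) linked_remove_edge unfolding P_def connected_in_def by metis
    then have "P ?F" using E'(1) by (auto simp: P_def)
    moreover have "card ?F < card E'" using p(5) q fin by (intro card_Diff1_less) auto
    ultimately show False using E'(2) by fastforce
  qed
  then show ?thesis using E'(1) by (auto simp: P_def is_tree_def graph_connected_iff)
qed

section \<open>Blocks\<close>

text \<open>A connected graph has one component, so without cutvertices at most one remains after a
  deletion. The vertex \<open>a\<close> excludes the empty remainder, which does not count as
  connected.\<close>

lemma is_blockD:
  assumes "\<forall>e\<in>eset B. e \<subseteq> vset B" "is_block B" "finite (vset B)"
  shows "connected_in (eset B) (vset B)"
    and "a \<in> vset B - {z} \<Longrightarrow> connected_in (eset B) (vset B - {z})"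
proof -
  show con: "connected_in (eset B) (vset B)" using assms by (simp add: is_block_def graph_connected_iff)
  assume a: "a \<in> vset B - {z}"
  show "connected_in (eset B) (vset B - {z})"
  proof (cases "z \<in> vset B")
    case False
    then show ?thesis using con by simp
  next
    case True
    let ?P = "parts (eset B) (vset B - {z})"
    have "num_components (delete_vertices B {z}) \<le> num_components B"
      using assms(2) True by (auto simp: is_block_def cutvertex_def)
    then have "card ?P \<le> 1"
      using assms(1) parts_connected_eq[OF con] by (simp add: num_components_eq num_components_delete)
    moreover have "finite ?P" using finite_parts[of "vset B - {z}"] assms(3) by simp
    moreover obtain K where K: "K \<in> ?P" "a \<in> K" using parts_cover[OF a] by blast
    ultimately have "?P = {K}" by (auto simp: card_le_Suc0_iff_eq)
    then have "vset B - {z} = K" using Union_parts[of "eset B" "vset B - {z}"] by simp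
    then show ?thesis using parts_connected[OF K(1)] by simp
  qed
qed

lemma is_blockI:
  assumes "\<forall>e\<in>eset B. e \<subseteq> vset B" "connected_in (eset B) (vset B)"
    "\<And>z. z \<in> vset B \<Longrightarrow> vset B \<noteq> {z} \<Longrightarrow> connected_in (eset B) (vset B - {z})"
  shows "is_block B"
proof -
  have "num_components (delete_vertices B {z}) \<le> num_components B" if "z \<in> vset B" for z
  proof (cases "vset B = {z}")
    \<comment> \<open>Deleting the only vertex leaves the null graph, which has no component, so the
      count cannot grow.\<close>
    case True
    then show ?thesis using assms(1) by (simp add: num_components_delete parts_def)
  next
    case False
    then show ?thesis
      using assms(1) parts_connected_eq[OF assms(2)] parts_connected_eq[OF assms(3)[OF that]]
      by (simp add: num_components_eq num_components_delete)
  qed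
  then show ?thesis
    using assms(2) by (auto simp: is_block_def cutvertex_def graph_connected_iff linorder_not_less)
qed

lemma finite_eset: "simple_graph G \<Longrightarrow> finite (eset G)"
  by (rule finite_subset[of _ "Pow (vset G)"]) (auto simp: simple_graph_def)

lemma finite_subgraphs:
  assumes "simple_graph G" shows "finite {H. is_subgraph H G}"
proof (rule finite_subset)
  show "{H. is_subgraph H G} \<subseteq> Pow (vset G) \<times> Pow (eset G)" by (auto simp: is_subgraph_def)
  show "finite (Pow (vset G) \<times> Pow (eset G))"
    using assms finite_eset[OF assms] by (simp add: simple_graph_def)
qed

text \<open>The edge with its ends is a block, and among the finitely many blocks containing it a
  largest one is maximal.\<close>

lemma edge_in_block:
  assumes G: "simple_graph G" and e: "{u, v} \<in> eset G"
  shows "\<exists>B\<in>graph_blocks G. {u, v} \<in> eset B"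
proof -
  let ?S = "{H. is_subgraph H G \<and> is_block H \<and> {u, v} \<in> eset H}"
  have fin: "finite (vset G)" "finite (eset G)"
    using G finite_eset[OF G] by (simp_all add: simple_graph_def)
  let ?H = "({u, v}, {{u, v}})"
  have "is_block ?H"
  proof (rule is_blockI)
    show "connected_in (eset ?H) (vset ?H)"
      by (rule connected_inI[of u]) (auto intro: linked_refl linked_edge)
    show "connected_in (eset ?H) (vset ?H - {z})" if "z \<in> vset ?H" "vset ?H \<noteq> {z}" for z
    proof -
      have "vset ?H - {z} = {u} \<or> vset ?H - {z} = {v}" using that by auto
      then show ?thesis using connected_singleton by metis
    qed
  qed simp
  then have "?H \<in> ?S" using e G by (auto simp: is_subgraph_def simple_graph_def)
  then have ne: "?S \<noteq> {}" by blast
  have finS: "finite ?S" by (rule finite_subset[OF _ finite_subgraphs[OF G]]) auto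
  \<comment> \<open>Vertices and edges are both counted, so a subgraph of at least the same size
    must be equal.\<close>
  define m :: "'a graph \<Rightarrow> nat" where "m H = card (vset H) + card (eset H)" for H
  have "Max (m ` ?S) \<in> m ` ?S" using ne finS by (intro Max_in) auto
  then obtain B where B: "B \<in> ?S" "m B = Max (m ` ?S)" by (metis (no_types, lifting) imageE)
  have max: "m H \<le> m B" if "H \<in> ?S" for H
    unfolding B(2) by (rule Max_ge) (use finS that in auto)
  have "H' = B" if H': "is_subgraph H' G" "is_block H'" "is_subgraph B H'" for H'
  proof -
    have "H' \<in> ?S" using H' B(1) by (auto simp: is_subgraph_def)
    then have le: "m H' \<le> m B" by (rule max)
    have sub: "vset B \<subseteq> vset H'" "eset B \<subseteq> eset H'" "finite (vset H')" "finite (eset H')"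
      using H' fin finite_subset by (auto simp: is_subgraph_def)
    then have "card (vset B) = card (vset H')" "card (eset B) = card (eset H')"
      using le card_mono[OF sub(3,1)] card_mono[OF sub(4,2)] by (auto simp: m_def)
    then show ?thesis using sub by (metis card_subset_eq prod.collapse)
  qed
  then have "B \<in> graph_blocks G" using B(1) by (auto simp: graph_blocks_def maximal_subgraphs_def)
  then show ?thesis using B(1) by blast
qed

section \<open>Paths in the block-cutvertex tree\<close>

lemma block_tree_adjacent:
  "\<not> adjacent (block_cutvertex_tree G) (Inl B) (Inl B')"
  "adjacent (block_cutvertex_tree G) (Inl B) (Inr u) \<longleftrightarrow> B \<in> graph_blocks G \<and> cutvertex G u \<and> u \<in> vset B"
  "adjacent (block_cutvertex_tree G) (Inr u) (Inl B) \<longleftrightarrow> B \<in> graph_blocks G \<and> cutvertex G u \<and> u \<in> vset B"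
  "\<not> adjacent (block_cutvertex_tree G) (Inr u) (Inr u')"
  by (auto simp: adjacent_def block_cutvertex_tree_def doubleton_eq_iff simp del: split_paired_Ex)

context
  fixes G :: "'a graph"
  assumes G: "simple_graph G"
begin

lemma block_subgraph: "B \<in> graph_blocks G \<Longrightarrow> is_subgraph B G"
  by (simp add: graph_blocks_def maximal_subgraphs_def)

lemma block_connected:
  assumes "B \<in> graph_blocks G" "a \<in> vset B - {z}"
  shows "connected_in (eset G) (vset B - {z})"
proof -
  have s: "is_subgraph B G" "is_block B" using assms by (auto simp: graph_blocks_def maximal_subgraphs_def)
  then have "connected_in (eset B) (vset B - {z})"
    using is_blockD(2)[of B a z] assms G finite_subset[of "vset B" "vset G"]
    by (auto simp: is_subgraph_def simple_graph_def)
  then show ?thesis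
    using s linked_mono[of "eset B" "vset B - {z}" _ _ "eset G" "vset B - {z}"]
    by (auto simp: connected_in_def is_subgraph_def)
qed

text \<open>The two blocks and a path from \<open>a\<close> to \<open>b\<close> avoiding
  \<open>v\<close> form a cyclic arrangement: their union stays connected after any single deletion,
  so it spans a block containing both.\<close>

lemma blocks_eq_if_linked:
  assumes B: "B \<in> graph_blocks G" "B' \<in> graph_blocks G"
    and v: "v \<in> vset B" "v \<in> vset B'" and a: "a \<in> vset B - {v}" and b: "b \<in> vset B' - {v}"
    and l: "linked (eset G) (vset G - {v}) a b"
  shows "B = B'"
proof -
  let ?E = "eset G"
  have "linked (eset (delete_vertices G {v})) (vset (delete_vertices G {v})) a b"
    using l linked_cong[of "vset G - {v}" "eset (delete_vertices G {v})" ?E] by (auto simp: delete_vertices_def)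
  then obtain p where p: "graph_path (delete_vertices G {v}) p" "hd p = a" "last p = b"
    using path_iff_linked by metis
  have pp: "p \<noteq> []" "distinct p" "set p \<subseteq> vset G - {v}" "successively (adjacent G) p"
    using p(1) successively_mono[of "adjacent (delete_vertices G {v})" p "adjacent G"]
    by (auto simp: graph_path_def delete_vertices_def adjacent_def)
  have conl: "connected_in ?E (set q)" if q: "q \<noteq> []" "successively (adjacent G) q" for q
  proof -
    obtain c q' where "q = c # q'" using q(1) by (cases q) auto
    then show ?thesis using linked_successively[of G c q' "set q"] q(2) by (intro connected_inI[of c]) auto
  qed
  have ab: "a \<in> set p" "b \<in> set p" using p pp(1) by auto
  have con: "connected_in ?E (vset B - {z})" "connected_in ?E (vset B' - {z})" if "z \<noteq> v" for z
    using block_connected[OF B(1), of v z] block_connected[OF B(2), of v z] v that by auto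
  define U where "U = vset B \<union> vset B' \<union> set p"
  have UG: "U \<subseteq> vset G"
    using block_subgraph[OF B(1)] block_subgraph[OF B(2)] pp(3) by (auto simp: U_def is_subgraph_def)
  have conU: "connected_in ?E (U - {z})" for z
  proof (cases "z = v")
    case True
    have "connected_in ?E ((vset B - {v}) \<union> set p)"
      using connected_Un[OF block_connected[OF B(1) a] conl[OF pp(1,4)]] a ab by blast
    then have "connected_in ?E ((vset B - {v}) \<union> set p \<union> (vset B' - {v}))"
      using connected_Un[OF _ block_connected[OF B(2) b]] b ab by blast
    moreover have "(vset B - {v}) \<union> set p \<union> (vset B' - {v}) = U - {z}"
      using pp(3) True by (auto simp: U_def)
    ultimately show ?thesis by simp
  next
    case zv: False
    \<comment> \<open>The blocks still meet in \<open>v\<close>. Deleting \<open>z\<close> cuts the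
      path into at most two segments, and each nonempty one keeps its end \<open>a\<close> or
      \<open>b\<close>, by which it is attached.\<close>
    let ?BB = "(vset B - {z}) \<union> (vset B' - {z})"
    have BB: "connected_in ?E ?BB" using connected_Un[OF con[OF zv]] v zv by blast
    have ext: "connected_in ?E (A \<union> set q)"
      if "connected_in ?E A" "successively (adjacent G) q" "q = [] \<or> set q \<inter> A \<noteq> {}" for A q
      using that connected_Un[OF that(1) conl[OF _ that(2)]] by (cases "q = []") auto
    show ?thesis
    proof (cases "z \<in> set p")
      case False
      then have "U - {z} = ?BB \<union> set p" by (auto simp: U_def)
      moreover have "a \<in> ?BB" using a False ab by auto
      ultimately show ?thesis using ext[OF BB pp(4)] ab by auto
    next
      case True
      then obtain p1 p2 where p12: "p = p1 @ z # p2" by (meson split_list)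
      then have s: "successively (adjacent G) p1" "successively (adjacent G) p2" "z \<notin> set p1" "z \<notin> set p2"
        using pp by (auto simp: successively_append_iff successively_Cons)
      have "p1 = [] \<or> a \<in> set p1 \<inter> ?BB"
        using p(2) p12 a s(3) by (cases p1) auto
      then have c1: "connected_in ?E (?BB \<union> set p1)" using ext[OF BB s(1)] by blast
      have "p2 = [] \<or> b \<in> set p2 \<inter> (?BB \<union> set p1)"
        using p(3) p12 b s(4) last_in_set[of p2] by (cases "p2 = []") auto
      then have "connected_in ?E (?BB \<union> set p1 \<union> set p2)" using ext[OF c1 s(2)] by blast
      moreover have "U - {z} = ?BB \<union> set p1 \<union> set p2" using p12 s by (auto simp: U_def)
      ultimately show ?thesis by simp
    qed
  qed
  let ?H = "induced G U"
  have block: "is_block ?H"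
  proof (rule is_blockI)
    have cong: "connected_in (eset ?H) A" if "connected_in ?E A" "A \<subseteq> U" for A
    proof -
      have "linked (eset ?H) A x y \<longleftrightarrow> linked ?E A x y" for x y
        by (rule linked_cong) (use that(2) in \<open>auto simp: induced_def\<close>)
      then show ?thesis using that(1) by (simp add: connected_in_def)
    qed
    have "connected_in ?E U"
    proof (rule connected_Un[of ?E "U - {v}" "vset B", THEN back_subst[of "connected_in ?E"]])
      show "connected_in ?E (vset B)"
      proof -
        have "is_block B" "is_subgraph B G" using B(1) by (auto simp: graph_blocks_def maximal_subgraphs_def)
        then show ?thesis
          using linked_mono[of "eset B" "vset B" _ _ ?E "vset B"]
          by (auto simp: connected_in_def is_subgraph_def is_block_def graph_connected_iff)
      qed
    qed (use conU a v in \<open>auto simp: U_def\<close>)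
    then show "connected_in (eset ?H) (vset ?H)" using cong by (simp add: induced_def)
    show "connected_in (eset ?H) (vset ?H - {z})" for z
      using cong[OF conU] by (simp add: induced_def)
  qed (auto simp: induced_def)
  \<comment> \<open>\<open>?H\<close> is a block containing both given blocks, so by maximality each
    of them equals it.\<close>
  have "?H = B''" if "B'' \<in> graph_blocks G" "vset B'' \<subseteq> U" for B''
  proof -
    have "is_subgraph B'' ?H" using block_subgraph[OF that(1)] that(2) unfolding is_subgraph_def induced_def by fastforce
    then show ?thesis
      using that(1) block is_subgraph_induced[OF UG] unfolding graph_blocks_def maximal_subgraphs_def by blast
  qed
  moreover have "vset B \<subseteq> U" "vset B' \<subseteq> U" by (auto simp: U_def)
  ultimately show ?thesis using B by metis
qed

text \<open>Consecutive blocks on the tree walk share a cutvertex other than \<open>v\<close>, and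
  each block stays connected without \<open>v\<close>; so the tree walk can be followed in
  \<open>G - v\<close>.\<close>

lemma block_tree_walk_linked:
  assumes "successively (adjacent (block_cutvertex_tree G)) (Inl B # q)" "last (Inl B # q) = Inl B0"
    "Inr v \<notin> set q" "B \<in> graph_blocks G" "b \<in> vset B0 - {v}"
  shows "\<exists>a\<in>vset B - {v}. linked (eset G) (vset G - {v}) a b"
  using assms
proof (induction "length q" arbitrary: q B rule: less_induct)
  case less
  have sub: "vset C \<subseteq> vset G" if "C \<in> graph_blocks G" for C
    using block_subgraph[OF that] by (simp add: is_subgraph_def)
  note adj = block_tree_adjacent
  show ?case
  proof (cases q)
    case Nil
    then have "B = B0" using less.prems by simp
    then show ?thesis using less.prems(4,5) sub[of B] by (intro bexI[of _ b]) (auto intro: linked_refl)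
  next
    case (Cons x q')
    then obtain u where x: "x = Inr u" using less.prems(1) by (cases x) (auto simp: adj simp del: split_paired_All split_paired_Ex)
    then have u: "u \<in> vset B" "u \<noteq> v" using less.prems Cons by (auto simp: adj)
    obtain y q'' where q': "q' = y # q''" using less.prems(2) Cons x by (cases q') auto
    then obtain C where y: "y = Inl C" using less.prems(1) Cons x q' by (cases y) (auto simp: adj simp del: split_paired_All split_paired_Ex)
    then have C: "C \<in> graph_blocks G" "u \<in> vset C" using less.prems(1) Cons x q' y by (auto simp: adj)
    have "\<exists>a\<in>vset C - {v}. linked (eset G) (vset G - {v}) a b"
      by (rule less.hyps) (use less.prems Cons x y q' C in auto)
    then obtain a where a: "a \<in> vset C - {v}" "linked (eset G) (vset G - {v}) a b" by blast
    have "linked (eset G) (vset C - {v}) u a"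
      using connected_in_linked[OF block_connected[OF C(1) a(1)]] C(2) u a(1) by auto
    then have "linked (eset G) (vset G - {v}) u a" by (rule linked_mono) (use sub[OF C(1)] in auto)
    then show ?thesis using u linked_trans[OF a(2)] by blast
  qed
qed

text \<open>The block \<open>C\<close> following \<open>r\<close> on the tree path is linked to
  \<open>b\<close> in \<open>G - r\<close>. If \<open>a\<close> were linked to \<open>b\<close> too,
  \<open>B\<close> and \<open>C\<close> would coincide, but a path repeats no vertex.\<close>

lemma block_root_separates:
  assumes root: "block_root_vertex G B0 B r" and a: "a \<in> vset B - {r}" and b: "b \<in> vset B0 - {r}"
  shows "r \<in> vset B" "\<not> linked (eset G) (vset G - {r}) a b"
proof -
  obtain p where p: "graph_path (block_cutvertex_tree G) (Inl B # Inr r # p)" "last (Inr r # p) = Inl B0"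
    using root by (auto simp: block_root_vertex_def tree_parent_def)
  then obtain y q where pq: "p = y # q" by (cases p) auto
  have s: "adjacent (block_cutvertex_tree G) (Inl B) (Inr r)" "adjacent (block_cutvertex_tree G) (Inr r) y"
    "successively (adjacent (block_cutvertex_tree G)) (y # q)" "distinct (Inl B # Inr r # y # q)"
    using p(1) pq by (auto simp: graph_path_def)
  then obtain C where y: "y = Inl C" using s(2) by (cases y) (auto simp: block_tree_adjacent simp del: split_paired_All split_paired_Ex)
  have BC: "B \<in> graph_blocks G" "r \<in> vset B" "C \<in> graph_blocks G" "r \<in> vset C" "B \<noteq> C"
    using s y by (auto simp: block_tree_adjacent)
  then show "r \<in> vset B" by simp
  obtain c where c: "c \<in> vset C - {r}" "linked (eset G) (vset G - {r}) c b"
    using block_tree_walk_linked[of C q B0 r b] s p(2) pq y BC b by auto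
  show "\<not> linked (eset G) (vset G - {r}) a b"
    using blocks_eq_if_linked[OF BC(1,3,2,4) a c(1)] linked_trans[OF linked_sym[OF c(2)], of a] BC(5) by blast
qed

end

text \<open>This supplies \<open>chosen\<close> and \<open>chosen_ex1\<close>: exactly one of the
  blocks with root vertex \<open>u\<close> reaches into a component of \<open>G - u\<close> away
  from \<open>r 0\<close>.\<close>

lemma block_root_edge_ex1:
  fixes G :: "'a graph" and B :: "nat \<Rightarrow> 'a graph" and k :: nat and r s :: "nat \<Rightarrow> 'a"
  assumes G: "simple_graph G" "graph_connected G"
    and blocks: "bij_betw B {0..k} (graph_blocks G)"
    and edge: "\<forall>i\<in>{0..k}. {r i, s i} \<in> eset (B i)"
    and root: "\<forall>i\<in>{1..k}. block_root_vertex G (B 0) (B i) (r i)"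
  shows "i \<le> k \<Longrightarrow> {r i, s i} \<in> eset G"
    and "i \<le> k \<Longrightarrow> \<not> linked (eset G) (vset G - {r i}) (s i) (r 0)"
    and "u \<in> vset G \<Longrightarrow> Y \<in> parts (eset G) (vset G - {u}) \<Longrightarrow> r 0 \<notin> Y \<Longrightarrow>
      \<exists>!t. t \<in> Y \<and> (u, t) \<in> {(r i, s i) | i. i \<le> k}"
proof -
  let ?E = "eset G" and ?V = "vset G"
  have block: "B i \<in> graph_blocks G" if "i \<le> k" for i using bij_betwE[OF blocks] that by simp
  have sub: "vset (B i) \<subseteq> ?V" "eset (B i) \<subseteq> ?E" "\<forall>e\<in>eset (B i). e \<subseteq> vset (B i)" if "i \<le> k" for i
    using block_subgraph[OF G(1) block[OF that]] by (auto simp: is_subgraph_def)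
  have edge': "{r i, s i} \<in> eset (B i)" if "i \<le> k" for i using edge that by simp
  show rs: "{r i, s i} \<in> ?E" if "i \<le> k" for i using subsetD[OF sub(2)[OF that] edge'[OF that]] .
  have mem: "r i \<in> vset (B i)" "s i \<in> vset (B i) - {r i}" if "i \<le> k" for i
  proof -
    have "card {r i, s i} = 2" using rs[OF that] G(1) by (auto simp: simple_graph_def)
    then have "r i \<noteq> s i" by auto
    moreover have "{r i, s i} \<subseteq> vset (B i)" using sub(3)[OF that] edge'[OF that] by blast
    ultimately show "r i \<in> vset (B i)" "s i \<in> vset (B i) - {r i}" by auto
  qed
  have sep: "\<not> linked ?E (?V - {r i}) b (r 0)" if "i \<le> k" "b \<in> vset (B i) - {r i}" for i b
  \<comment> \<open>Here \<open>r 0\<close> is itself deleted, so nothing is linked to it; this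
    covers \<open>i = 0\<close>, where no parent cutvertex exists.\<close>
  proof (cases "r i = r 0")
    case True
    then show ?thesis using linked_in by fastforce
  next
    case False
    then have "i \<in> {1..k}" using that by (cases i) auto
    then show ?thesis
      using block_root_separates(2)[OF G(1) root[rule_format], of i b "r 0"] that mem(1)[of 0] False by auto
  qed
  then show "i \<le> k \<Longrightarrow> \<not> linked ?E (?V - {r i}) (s i) (r 0)" using mem by blast
  assume u: "u \<in> ?V" and Y: "Y \<in> parts ?E (?V - {u})" and r0: "r 0 \<notin> Y"
  have r0V: "r 0 \<in> ?V" using mem(1)[of 0] sub(1)[of 0] by auto
  have con: "connected_in ?E ?V" using G(2) by (simp add: graph_connected_iff)
  have YV: "Y \<subseteq> ?V - {u}" using parts_subset[OF Y] .
  obtain y where y: "y \<in> Y" "{y, u} \<in> ?E" using part_touches[OF con u Y] by (auto simp: touches_def)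
  obtain C where C: "C \<in> graph_blocks G" "{y, u} \<in> eset C" using edge_in_block[OF G(1) y(2)] by blast
  then obtain i where i: "i \<le> k" "C = B i" using bij_betw_imp_surj_on[OF blocks] by (metis atLeastAtMost_iff imageE)
  have "{y, u} \<subseteq> vset (B i)" using C(2) sub(3)[OF i(1)] unfolding i(2) by blast
  then have yu: "y \<in> vset (B i)" "u \<in> vset (B i)" "y \<noteq> u" using y YV by auto
  have BY: "b \<in> Y" if "b \<in> vset (B i) - {u}" for b
  proof -
    have "linked ?E (vset (B i) - {u}) y b"
      using connected_in_linked[OF block_connected[OF G(1) block[OF i(1)], of y u]] yu that by auto
    then have "linked ?E (?V - {u}) y b" by (rule linked_mono) (use sub(1)[OF i(1)] in auto)
    then show ?thesis using parts_linked[OF Y y(1)] by blast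
  qed
  \<comment> \<open>Otherwise \<open>r i\<close> lies in \<open>Y\<close> and separates
    \<open>u\<close> from \<open>r 0\<close>, yet \<open>u\<close> reaches \<open>r 0\<close>
    outside \<open>Y\<close>.\<close>
  have ri: "r i = u"
  proof (rule ccontr)
    assume n: "r i \<noteq> u"
    have "u \<in> vset (B i) - {r i}" using yu n by simp
    then have nl: "\<not> linked ?E (?V - {r i}) u (r 0)" using sep i(1) by blast
    have "r i \<in> Y" using BY mem(1)[OF i(1)] n by simp
    moreover have "r 0 \<in> Y \<or> linked ?E (?V - Y) u (r 0)"
    proof (rule linked_from_outside)
      show "linked ?E ?V u (r 0)" using connected_in_linked[OF con u r0V] .
      fix b c assume "b \<in> Y" "c \<in> ?V - Y" "{b, c} \<in> ?E"
      then have "c = u" using parts_closed[OF Y, of b c] by blast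
      then show "linked ?E (?V - Y) u c" using u YV by (auto intro: linked_refl)
    qed (use YV in auto)
    ultimately have "linked ?E (?V - {r i}) u (r 0)"
      using r0 linked_mono[of ?E "?V - Y" u "r 0" ?E "?V - {r i}"] by auto
    then show False using nl by blast
  qed
  show "\<exists>!t. t \<in> Y \<and> (u, t) \<in> {(r i, s i) | i. i \<le> k}"
  proof (rule ex_ex1I)
    have "s i \<in> Y" using BY mem(2)[OF i(1)] ri by simp
    then show "\<exists>t. t \<in> Y \<and> (u, t) \<in> {(r i, s i) | i. i \<le> k}" using ri i(1) by blast
  next
    fix t t' assume "t \<in> Y \<and> (u, t) \<in> {(r i, s i) | i. i \<le> k}" "t' \<in> Y \<and> (u, t') \<in> {(r i, s i) | i. i \<le> k}"
    then obtain j j' where j: "j \<le> k" "r j = u" "s j = t" "t \<in> Y" and j': "j' \<le> k" "r j' = u" "s j' = t'" "t' \<in> Y"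
      by auto
    \<comment> \<open>Two candidates in \<open>Y\<close> are linked in \<open>G - u\<close>, so
      their blocks, which share \<open>u\<close>, coincide.\<close>
    have "linked ?E (?V - {u}) t t'"
      using connected_in_linked[OF parts_connected[OF Y] j(4) j'(4)] YV by (rule linked_mono[OF _ order_refl])
    then have "B j = B j'"
      using blocks_eq_if_linked[OF G(1) block[OF j(1)] block[OF j'(1)], of u t t'] mem[OF j(1)] mem[OF j'(1)] j j' by simp
    then have "j = j'" using blocks j(1) j'(1) by (auto simp: bij_betw_def inj_on_def)
    then show "t = t'" using j j' by simp
  qed
qed

text \<open>A 2-cut containing \<open>u\<close> is determined by its other vertex; the value 0 for
  pairs that are no 2-cuts allows summing over all vertices, as \<open>wsum\<close> does.\<close>

lemma sum_over_2cuts: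
  assumes "simple_graph G" "u \<in> vset G"
  shows "(\<Sum>F\<in>{F \<in> nontrivial_2cuts G. u \<in> F}. g F u) =
    (\<Sum>a\<in>vset G. if {u, a} \<in> nontrivial_2cuts G then g {u, a} u else (0::nat))"
proof -
  let ?A = "{a \<in> vset G. {u, a} \<in> nontrivial_2cuts G}"
  have "bij_betw (\<lambda>a. {u, a}) ?A {F \<in> nontrivial_2cuts G. u \<in> F}"
  proof (rule bij_betw_imageI)
    show "inj_on (\<lambda>a. {u, a}) ?A" by (auto simp: inj_on_def doubleton_eq_iff)
    show "(\<lambda>a. {u, a}) ` ?A = {F \<in> nontrivial_2cuts G. u \<in> F}"
    proof (intro equalityI subsetI)
      fix F assume F: "F \<in> {F \<in> nontrivial_2cuts G. u \<in> F}"
      then have "F \<subseteq> vset G" "card F = 2" "u \<in> F" by (auto simp: nontrivial_2cuts_def)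
      then obtain a where "F = {u, a}" "a \<in> vset G" by (auto simp: card_2_iff)
      then show "F \<in> (\<lambda>a. {u, a}) ` ?A" using F by auto
    qed auto
  qed
  then have "(\<Sum>F\<in>{F \<in> nontrivial_2cuts G. u \<in> F}. g F u) = (\<Sum>a\<in>?A. g {u, a} u)"
    by (rule sum.reindex_bij_betw[symmetric])
  also have "\<dots> = (\<Sum>a\<in>vset G. if {u, a} \<in> nontrivial_2cuts G then g {u, a} u else 0)"
    using assms by (intro sum.inter_filter) (simp add: simple_graph_def)
  finally show ?thesis .
qed

theorem theorem3p4:
  fixes G :: "'a graph"
    and f :: "'a \<Rightarrow> int"
    and \<omega> :: "'a set \<times> 'a \<Rightarrow> nat"
    and B :: "nat \<Rightarrow> 'a graph"
    and k :: nat
    and r s :: "nat \<Rightarrow> 'a"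
  assumes "simple_graph G" and "graph_connected G" and "K4_minor_free G"
    and "card (vset G) \<ge> 2"
    and "\<forall>v\<in>vset G. f v \<ge> 2"
    and "\<forall>u v. {u, v} \<in> nontrivial_2cuts G \<longrightarrow>
           int (\<omega> ({u, v}, u)) + int (\<omega> ({u, v}, v)) = int (num_bridges G {u, v}) - 2"
    and "\<forall>u\<in>vset G.
           (\<Sum>F\<in>{F \<in> nontrivial_2cuts G. u \<in> F}. int (\<omega> (F, u)))
             + int (num_components (delete_vertices G {u})) - 1 \<le> f u - 2"
    and "{r 0, s 0} \<in> eset G" and "num_bridges G {r 0, s 0} \<le> 1"
    and "bij_betw B {0..k} (graph_blocks G)" and "{r 0, s 0} \<in> eset (B 0)"
    and "\<forall>i\<in>{1..k}. block_root_vertex G (B 0) (B i) (r i)"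
    and "\<forall>i\<in>{1..k}. {r i, s i} \<in> eset (B i) \<and> num_bridges G {r i, s i} \<le> 1"
  shows "\<exists>T. is_spanning_tree T G \<and>
           (\<forall>v\<in>vset G. int (vdegree T v) \<le> f v) \<and>
           (\<forall>v\<in>{r 0} \<union> s ` {0..k}. int (vdegree T v) \<le> f v - 1) \<and>
           (\<forall>i\<in>{0..k}.
              (num_bridges G {r i, s i} = 0 \<longrightarrow> {r i, s i} \<in> eset T) \<and>
              (num_bridges G {r i, s i} = 1 \<longrightarrow> {r i, s i} \<notin> eset T))"
proof -
  let ?V = "vset G" and ?E = "eset G" and ?C = "{(r i, s i) | i. i \<le> k}"
  define w where "w u v = (if {u, v} \<in> nontrivial_2cuts G then \<omega> ({u, v}, u) else 0)" for u v
  note G = assms(1,2)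
  have sub: "\<forall>e\<in>?E. e \<subseteq> ?V" and fin: "finite ?V" using G(1) by (auto simp: simple_graph_def)
  have con: "connected_in ?E ?V" using G(2) by (simp add: graph_connected_iff)
  have edge: "\<forall>i\<in>{0..k}. {r i, s i} \<in> eset (B i)" and few: "\<And>i. i \<le> k \<Longrightarrow> num_bridges G {r i, s i} \<le> 1"
  proof -
    have "{r i, s i} \<in> eset (B i) \<and> num_bridges G {r i, s i} \<le> 1" if "i \<le> k" for i
      using assms(9,11,13) that by (cases i) auto
    then show "\<forall>i\<in>{0..k}. {r i, s i} \<in> eset (B i)" "\<And>i. i \<le> k \<Longrightarrow> num_bridges G {r i, s i} \<le> 1" by auto
  qed
  note roots = block_root_edge_ex1[OF G assms(10) edge assms(12)]
  have r0: "r 0 \<in> ?V" using assms(8) sub by auto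
  interpret rooted_graph ?V ?E "r 0" ?C w
  proof
    show "\<not> K4_model ?E ?V b" for b
      using K4_minor_if_model[OF G(1)] assms(3) by (auto simp: K4_minor_free_def)
    show "e \<subseteq> ?V \<and> card e = 2" if "e \<in> ?E" for e using G(1) that by (simp add: simple_graph_def)
    show "{u, t} \<in> ?E \<and> card (common_parts ?E ?V u t) \<le> 1 \<and> \<not> linked ?E (?V - {u}) t (r 0)"
      if "(u, t) \<in> ?C" for u t
      using that roots(1,2) few by (auto simp: num_bridges_eq[OF sub])
    show "card (common_parts ?E ?V u v) \<le> w u v + w v u + 2"
      if "u \<in> ?V" "v \<in> ?V" "u \<noteq> v" "3 \<le> card (common_parts ?E ?V u v)" for u v
    proof -
      have F: "{u, v} \<in> nontrivial_2cuts G"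
        using that by (simp add: nontrivial_2cuts_def num_bridges_eq[OF sub])
      moreover have "{v, u} \<in> nontrivial_2cuts G" using F by (simp add: insert_commute)
      moreover have "int (\<omega> ({u, v}, u)) + int (\<omega> ({u, v}, v)) = int (num_bridges G {u, v}) - 2"
        using assms(6) F by blast
      ultimately show ?thesis unfolding w_def by (simp add: num_bridges_eq[OF sub] insert_commute)
    qed
  qed (use fin con r0 roots(3) in simp_all)
  obtain E' where E': "E' \<subseteq> ?E - forbidden" "\<forall>a\<in>?V. linked E' ?V a (r 0)" "\<forall>a\<in>?V. bounded E' a"
    "edge_deg E' (r 0) \<le> wsum (r 0) ?V + card (parts ?E (?V - {r 0}))"
    using bounded_spanning_set by blast
  have finE': "finite E'" using E'(1) finite_E by (meson Diff_subset finite_subset)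
  have conE': "connected_in E' ?V" using E'(2) r0 linked_sym by (metis connected_inI)
  have subE': "\<forall>e\<in>E'. e \<subseteq> ?V" using E'(1) sub by blast
  obtain E'' where E'': "E'' \<subseteq> E'" "is_tree (?V, E'')" using spanning_tree_in[OF finE' conE' subE'] by blast
  have tree: "is_spanning_tree (?V, E'') G"
    using E'' E'(1) subE' by (auto simp: is_spanning_tree_def is_subgraph_def)
  have conE'': "connected_in E'' ?V" using E''(2) by (simp add: is_tree_def graph_connected_iff)
  have deg: "int (vdegree (?V, E'') v) \<le> int (edge_deg E' v)" for v
    using edge_deg_mono[OF finE' E''(1), of v] by (simp add: vdegree_def edge_deg_def)
  \<comment> \<open>The hypothesis on \<open>f\<close> rearranged: \<open>c(G - u) - 1\<close>
    against \<open>f u - 2\<close> leaves the constant 1 of \<open>bounded\<close>.\<close>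
  have f: "int (wsum u ?V + card (parts ?E (?V - {u})) + 1) \<le> f u" if "u \<in> ?V" for u
  proof -
    have "(\<Sum>F\<in>{F \<in> nontrivial_2cuts G. u \<in> F}. \<omega> (F, u)) = wsum u ?V"
      unfolding wsum_def w_def using sum_over_2cuts[OF G(1) that, of "\<lambda>F u. \<omega> (F, u)"] .
    then have "(\<Sum>F\<in>{F \<in> nontrivial_2cuts G. u \<in> F}. int (\<omega> (F, u))) = int (wsum u ?V)"
      by (metis of_nat_sum)
    then show ?thesis
      using assms(7) that by (fastforce simp: num_components_delete[OF sub])
  qed
  have "int (vdegree (?V, E'') v) \<le> f v" if "v \<in> ?V" for v
    using deg[of v] E'(3) f[OF that] that by (fastforce simp: bounded_def)
  moreover have "int (vdegree (?V, E'') v) \<le> f v - 1" if v: "v \<in> {r 0} \<union> s ` {0..k}" for v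
  \<comment> \<open>The saving at \<open>r 0\<close> comes from its separate bound, that at
    \<open>s i\<close> from the extra 1 in \<open>bounded\<close>.\<close>
  proof (cases "v = r 0")
    case True
    then show ?thesis using deg[of v] E'(4) f[OF r0] by simp
  next
    case False
    then obtain i where i: "i \<le> k" "v = s i" using v by auto
    then have "v \<in> snd ` ?C" by force
    moreover have "v \<in> ?V" using roots(1)[OF i(1)] sub i by auto
    moreover have "bounded E' v" using E'(3) calculation(2) by blast
    ultimately have "edge_deg E' v + 1 \<le> wsum v ?V + card (parts ?E (?V - {v})) + 1"
      unfolding bounded_def by presburger
    then show ?thesis using deg[of v] f[OF \<open>v \<in> ?V\<close>] by linarith
  qed
  \<comment> \<open>The tree connects the ends, and with no common bridge only the edge itself can
    do so.\<close>
  moreover have "{r i, s i} \<in> E''" if "i \<le> k" "num_bridges G {r i, s i} = 0" for i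
  proof (rule spanning_edge_needed)
    have "{r i, s i} \<in> ?E" using roots(1) that by blast
    then have ends: "r i \<in> ?V" "s i \<in> ?V" "r i \<noteq> s i" using edge_ends by blast+
    show "r i \<noteq> s i" using ends(3) .
    show "linked E'' ?V (r i) (s i)" using connected_in_linked[OF conE''] ends by blast
    show "E'' \<subseteq> ?E" using E''(1) E'(1) by blast
    have "finite (common_parts ?E ?V (r i) (s i))" using finite_parts_V by (simp add: common_parts_def)
    then show "common_parts ?E ?V (r i) (s i) = {}" using that by (simp add: num_bridges_eq[OF sub])
  qed
  moreover have "{r i, s i} \<notin> E''" if "i \<le> k" "num_bridges G {r i, s i} = 1" for i
  proof -
    have "common_parts ?E ?V (r i) (s i) \<noteq> {}" using that by (auto simp: num_bridges_eq[OF sub])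
    then have "{r i, s i} \<in> forbidden" using that(1) by (auto simp: forbidden_def)
    then show ?thesis using E''(1) E'(1) by blast
  qed
  ultimately show ?thesis using tree by (intro exI[of _ "(?V, E'')"]) auto
qed

end
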